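(* Let $n,m\ge 1$, let $A,B,C_1,\dots,C_m\in\mathbb{C}^{n\times n}$ and $r_1,\dots,r_m,s_1,\dots,s_m\in\mathbb{C}^n$. Then the eigenvalue problem with eigenvector nonlinearities $$\Bigl(A+\lambda B+\frac{r_1^Tx}{s_1^Tx}C_1+\cdots+\frac{r_m^Tx}{s_m^Tx}C_m\Bigr)x=0$$ has at most $N_s=\binom{n+m}{m+1}$ isolated solutions $(\lambda,x)$.
   Context: A solution is a pair $(\lambda,x)$ with $\lambda\in\mathbb{C}$, $x\in\mathbb{C}^n\setminus\{0\}$ and $s_i^Tx\neq 0$ for all $i$ (so that the quotients are defined) satisfying the displayed equation. The equation is invariant under scaling $x\mapsto\alpha x$, $\alpha\in\mathbb{C}\setminus\{0\}$, and solutions whose vectors are nonzero scalar multiples of each other (with the same $\lambda$) are identified; that is, solutions are counted as points of $\mathbb{C}\times\mathbb{P}^{n-1}$, and "isolated" is meant in that space. The superscript $T$ denotes transpose without conjugation. *)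

theory Defs
  imports "HOL-Analysis.Analysis"
begin

text \<open>
  The points of the complex projective space \<open>P(\<complex>\<^sup>n)\<close> with \<open>n = CARD('n)\<close>: nonzero vectors modulo
  nonzero scalars. The relation is partial; the zero vector represents no point.
\<close>

definition proj_rel :: "complex ^ 'n \<Rightarrow> complex ^ 'n \<Rightarrow> bool"
  where "proj_rel x y \<longleftrightarrow> x \<noteq> 0 \<and> y \<noteq> 0 \<and> (\<exists>\<alpha>. \<alpha> \<noteq> 0 \<and> y = \<alpha> *s x)"

lemma part_equivp_proj_rel: "part_equivp (proj_rel :: complex ^ 'n \<Rightarrow> complex ^ 'n \<Rightarrow> bool)"
proof (rule part_equivpI)
  have "proj_rel (1 :: complex ^ 'n) 1"
    unfolding proj_rel_def by (auto intro!: exI[of _ 1])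
  then show "\<exists>x :: complex ^ 'n. proj_rel x x" ..
  show "symp (proj_rel :: complex ^ 'n \<Rightarrow> complex ^ 'n \<Rightarrow> bool)"
  proof (rule sympI)
    fix x y :: "complex ^ 'n"
    assume "proj_rel x y"
    then obtain \<alpha> where "x \<noteq> 0" "y \<noteq> 0" "\<alpha> \<noteq> 0" "y = \<alpha> *s x"
      unfolding proj_rel_def by blast
    then have "inverse \<alpha> \<noteq> 0" "x = inverse \<alpha> *s y"
      by (simp_all add: vector_smult_assoc)
    with \<open>x \<noteq> 0\<close> \<open>y \<noteq> 0\<close> show "proj_rel y x"
      unfolding proj_rel_def by blast
  qed
  show "transp (proj_rel :: complex ^ 'n \<Rightarrow> complex ^ 'n \<Rightarrow> bool)"
  proof (rule transpI)
    fix x y z :: "complex ^ 'n"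
    assume "proj_rel x y" "proj_rel y z"
    then obtain \<alpha> \<beta> where "x \<noteq> 0" "z \<noteq> 0" "\<alpha> \<noteq> 0" "\<beta> \<noteq> 0" "y = \<alpha> *s x" "z = \<beta> *s y"
      unfolding proj_rel_def by blast
    moreover from this have "\<beta> * \<alpha> \<noteq> 0" "z = (\<beta> * \<alpha>) *s x"
      by (simp_all add: vector_smult_assoc)
    ultimately show "proj_rel x z"
      unfolding proj_rel_def by blast
  qed
qed

quotient_type (overloaded) 'n proj_space = "complex ^ 'n" / partial: proj_rel
  morphisms rep_proj proj_point
  by (rule part_equivp_proj_rel)

lemma proj_point_eq_iff:
  assumes "x \<noteq> 0" "y \<noteq> 0"
  shows "proj_point x = proj_point y \<longleftrightarrow> (\<exists>\<alpha>. \<alpha> \<noteq> 0 \<and> y = \<alpha> *s x)"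
proof -
  have refl: "proj_rel z z" if "z \<noteq> 0" for z :: "complex ^ 'b"
    using that unfolding proj_rel_def by (auto intro!: exI[of _ 1])
  show ?thesis
    using Quotient3_rel[OF Quotient3_proj_space, of x y] refl assms
    by (auto simp: proj_rel_def)
qed

text \<open>The quotient topology induced by the Euclidean topology of \<open>\<complex>\<^sup>n - {0}\<close>.\<close>

instantiation proj_space :: (finite) topological_space
begin

definition open_proj_space :: "'a proj_space set \<Rightarrow> bool"
  where "open_proj_space U \<longleftrightarrow> open {x. x \<noteq> 0 \<and> proj_point x \<in> U}"

instance
proof
  have "{x :: complex ^ 'a. x \<noteq> 0 \<and> proj_point x \<in> UNIV} = - {0}"
    by auto
  then show "open (UNIV :: 'a proj_space set)"
    unfolding open_proj_space_def by (metis open_Compl closed_singleton)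
next
  fix S T :: "'a proj_space set"
  assume "open S" "open T"
  then have "open ({x. x \<noteq> 0 \<and> proj_point x \<in> S} \<inter> {x. x \<noteq> 0 \<and> proj_point x \<in> T})"
    unfolding open_proj_space_def by (rule open_Int)
  also have "\<dots> = {x. x \<noteq> 0 \<and> proj_point x \<in> S \<inter> T}"
    by auto
  finally show "open (S \<inter> T)"
    unfolding open_proj_space_def .
next
  fix K :: "'a proj_space set set"
  assume "\<forall>S\<in>K. open S"
  then have "open (\<Union>S\<in>K. {x. x \<noteq> 0 \<and> proj_point x \<in> S})"
    unfolding open_proj_space_def by (intro open_UN) auto
  also have "\<dots> = {x. x \<noteq> 0 \<and> proj_point x \<in> \<Union>K}"
    by auto
  finally show "open (\<Union>K)"
    unfolding open_proj_space_def .
qed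

end

text \<open>
  The product \<^const>\<open>scalar_product\<close> is bilinear: \<open>scalar_product v x = v\<^sup>T x\<close>, without conjugation.
  The scalar multiple of a matrix is written with \<^const>\<open>map_matrix\<close>, because \<open>*s\<close> would need
  a coefficient of the type of the rows.
\<close>

definition nep_matrix ::
  "nat \<Rightarrow> complex ^ 'n ^ 'n \<Rightarrow> complex ^ 'n ^ 'n \<Rightarrow> (nat \<Rightarrow> complex ^ 'n ^ 'n) \<Rightarrow>
   (nat \<Rightarrow> complex ^ 'n) \<Rightarrow> (nat \<Rightarrow> complex ^ 'n) \<Rightarrow> complex \<Rightarrow> complex ^ 'n \<Rightarrow> complex ^ 'n ^ 'n"
  where "nep_matrix m A B C r s lam x =
    A + map_matrix ((*) lam) B
      + (\<Sum>i=1..m. map_matrix ((*) (scalar_product (r i) x / scalar_product (s i) x)) (C i))"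

definition is_nep_solution ::
  "nat \<Rightarrow> complex ^ 'n ^ 'n \<Rightarrow> complex ^ 'n ^ 'n \<Rightarrow> (nat \<Rightarrow> complex ^ 'n ^ 'n) \<Rightarrow>
   (nat \<Rightarrow> complex ^ 'n) \<Rightarrow> (nat \<Rightarrow> complex ^ 'n) \<Rightarrow> complex \<Rightarrow> complex ^ 'n \<Rightarrow> bool"
  where "is_nep_solution m A B C r s lam x \<longleftrightarrow>
    x \<noteq> 0 \<and> (\<forall>i\<in>{1..m}. scalar_product (s i) x \<noteq> 0) \<and> nep_matrix m A B C r s lam x *v x = 0"

definition nep_solutions ::
  "nat \<Rightarrow> complex ^ 'n ^ 'n \<Rightarrow> complex ^ 'n ^ 'n \<Rightarrow> (nat \<Rightarrow> complex ^ 'n ^ 'n) \<Rightarrow>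
   (nat \<Rightarrow> complex ^ 'n) \<Rightarrow> (nat \<Rightarrow> complex ^ 'n) \<Rightarrow> (complex \<times> 'n proj_space) set"
  where "nep_solutions m A B C r s =
    {(lam, proj_point x) | lam x. is_nep_solution m A B C r s lam x}"

end

theory Submission
  imports Defs "HOL-Complex_Analysis.Conformal_Mappings"
begin

text \<open>
  With \<open>\<mu>\<^sub>i = r\<^sub>i\<^sup>T x / s\<^sub>i\<^sup>T x\<close> as further unknowns the problem becomes a system of \<open>N = n + m\<close> equations which are
  affine in the \<open>k = m + 1\<close> parameters \<open>(\<lambda>, \<mu>)\<close> and linear in \<open>x\<close>. It is moved along the line towards a system
  whose equations are products \<open>l\<^sub>i(\<lambda>, \<mu>) h\<^sub>i(x)\<close> of linear forms in general position. For this system the forms that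
  are linear in \<open>x\<close> and of large degree \<open>d\<close> in the parameters are, modulo the multiples of the equations, spanned by
  \<open>N choose k\<close> elements. The same then holds at all but finitely many points of the line, where there are therefore
  at most \<open>N choose k\<close> zeros with different parameters. On the other hand every isolated zero of the original
  system persists nearby on the line. This follows from a minimum principle: a square holomorphic
  system without zeros cannot have an interior minimum of its modulus below the boundary values.
\<close>

section \<open>Linear algebra over finite index sets\<close>

text \<open>The original system may have whole curves of zeros, so its zeros cannot be counted
  directly. Hence the detour over a general member of the line, where a span of at most
  \<open>N choose k\<close> elements bounds the zeros: a polynomial in the parameters that separates
  them, times one vector entry, is a form linear in \<open>x\<close>. Such forms tell zeros apart
  only by their parameters. For isolated solutions this is no loss, since two different solutions
  with equal parameters are joined by further solutions. The number \<open>N choose k\<close> counts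
  the sets T of k equations: l_i = 0 for i in T and h_i = 0 for the other n - 1 indices determine
  one point. Homogeneous parameters keep everything in one degree, where finitely many monomials
  span and the dependence on the line parameter becomes an eigenvalue problem. No multiplicities are
  needed, only one zero near each isolated one. A minimum principle gives this much without degree
  theory.\<close>

lemma underdetermined_system:
  fixes L :: "nat \<Rightarrow> ('j \<Rightarrow> complex) \<Rightarrow> complex"
  assumes lin: "\<And>i a b \<xi> \<zeta>. i < N \<Longrightarrow> L i (\<lambda>j. a * \<xi> j + b * \<zeta> j) = a * L i \<xi> + b * L i \<zeta>"
    and "finite J" "N < card J"
  shows "\<exists>\<xi>. (\<exists>j. \<xi> j \<noteq> 0) \<and> (\<forall>j. j \<notin> J \<longrightarrow> \<xi> j = 0) \<and> (\<forall>i<N. L i \<xi> = 0)"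
  using assms
proof (induction N arbitrary: J)
  case 0
  then obtain j where "j \<in> J"
    by fastforce
  then show ?case
    by (intro exI[of _ "\<lambda>i. if i = j then 1 else 0"]) auto
next
  case (Suc N)
  note lin = Suc.prems(1)
  obtain j where "j \<in> J"
    using Suc.prems by fastforce
  have IH: "\<exists>\<xi>. (\<exists>j. \<xi> j \<noteq> 0) \<and> (\<forall>j. j \<notin> J - {i} \<longrightarrow> \<xi> j = 0) \<and> (\<forall>i<N. L i \<xi> = 0)"
    if "i \<in> J" for i
    using Suc.prems that by (intro Suc.IH) auto
  obtain \<xi> j1 where \<xi>: "\<xi> j1 \<noteq> 0" "\<And>j. j \<notin> J \<Longrightarrow> \<xi> j = 0" "\<And>i. i < N \<Longrightarrow> L i \<xi> = 0"
    using IH[OF \<open>j \<in> J\<close>] by auto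
  obtain \<zeta> j2 where \<zeta>: "\<zeta> j2 \<noteq> 0" "\<And>j. j \<notin> J - {j1} \<Longrightarrow> \<zeta> j = 0" "\<And>i. i < N \<Longrightarrow> L i \<zeta> = 0"
    using IH[of j1] \<xi> by blast
  show ?case
  proof (cases "L N \<zeta> = 0")
    case True
    then show ?thesis
      using \<zeta> by (intro exI[of _ \<zeta>]) (auto simp: less_Suc_eq)
  next
    case False
    \<comment> \<open>This combination cancels \<open>L N\<close>. Its entry at \<open>j1\<close> is
      \<open>- L N \<zeta> * \<xi> j1\<close>, nonzero because \<open>\<zeta>\<close> was found with
      \<open>j1\<close> removed from its support.\<close>
    define \<theta> where "\<theta> = (\<lambda>j. L N \<xi> * \<zeta> j + (- L N \<zeta>) * \<xi> j)"
    have "L i \<theta> = 0" if "i < Suc N" for i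
      using lin[OF that, of "L N \<xi>" \<zeta> "- L N \<zeta>" \<xi>] \<xi>(3) \<zeta>(3) that
      unfolding \<theta>_def by (cases "i = N") auto
    moreover have "\<theta> j1 \<noteq> 0" "\<And>j. j \<notin> J \<Longrightarrow> \<theta> j = 0"
      using \<xi> \<zeta> False unfolding \<theta>_def by auto
    ultimately show ?thesis by blast
  qed
qed

lemma vandermonde_independent:
  fixes c t :: "'i \<Rightarrow> complex"
  assumes "finite A" "inj_on t A" "\<And>a. a < card A \<Longrightarrow> (\<Sum>i\<in>A. c i * t i ^ a) = 0" "i \<in> A"
  shows "c i = 0"
proof -
  \<comment> \<open>The Lagrange polynomial of the node \<open>t i\<close>, not normalised: it has
    degree \<open>card A - 1\<close> and vanishes at the other nodes, so the relations applied to
    its coefficients leave only the term of \<open>c i\<close>.\<close>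
  define p where "p = (\<Prod>j\<in>A - {i}. [:- t j, 1:])"
  have "degree p < card A"
  proof -
    have "degree p = (\<Sum>j\<in>A - {i}. degree [:- t j, 1:])"
      unfolding p_def by (rule degree_prod_eq_sum_degree) auto
    then show ?thesis
      using assms card_gt_0_iff[of A] by auto
  qed
  have "(\<Sum>j\<in>A. c j * poly p (t j)) = (\<Sum>j\<in>A. \<Sum>a\<le>degree p. coeff p a * (c j * t j ^ a))"
    by (intro sum.cong) (simp_all add: poly_altdef sum_distrib_left mult_ac)
  also have "\<dots> = (\<Sum>a\<le>degree p. coeff p a * (\<Sum>j\<in>A. c j * t j ^ a))"
    by (subst sum.swap) (simp add: sum_distrib_left)
  also have "\<dots> = 0"
    using \<open>degree p < card A\<close> assms(3) by (intro sum.neutral) auto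
  finally have "(\<Sum>j\<in>A. c j * poly p (t j)) = 0" .
  moreover have "poly p (t j) = 0" if "j \<in> A - {i}" for j
    using that \<open>finite A\<close> unfolding p_def poly_prod by (intro prod_zero) auto
  ultimately have "c i * poly p (t i) = 0"
    using assms by (simp add: sum.remove)
  moreover have "poly p (t i) \<noteq> 0"
    using assms unfolding p_def poly_prod by (auto simp: inj_on_def)
  ultimately show ?thesis by simp
qed

text \<open>Existence follows from uniqueness by counting. The additional unknown
  \<open>None\<close> scales the right-hand side, so the homogeneous system has one unknown more
  than equations, and \<open>vandermonde_independent\<close> excludes that this unknown
  vanishes.\<close>

lemma vandermonde_dual_basis:
  fixes t :: "'i \<Rightarrow> complex"
  assumes "finite A" "inj_on t A" "a < card A"
  shows "\<exists>c. \<forall>a'<card A. (\<Sum>i\<in>A. c i * t i ^ a') = (if a' = a then 1 else 0)"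
proof -
  define L where "L = (\<lambda>a' (\<xi> :: 'i option \<Rightarrow> complex).
    (\<Sum>i\<in>A. \<xi> (Some i) * t i ^ a') - (if a' = a then \<xi> None else 0))"
  have "L a' (\<lambda>j. x * \<xi> j + y * \<zeta> j) = x * L a' \<xi> + y * L a' \<zeta>" for a' x y \<xi> \<zeta>
    by (simp add: L_def sum.distrib sum_distrib_left algebra_simps)
  moreover have "card A < card (insert None (Some ` A))"
    using assms(1) by (simp add: card_image)
  ultimately obtain \<xi> where \<xi>: "\<exists>j. \<xi> j \<noteq> 0" "\<And>j. j \<notin> insert None (Some ` A) \<Longrightarrow> \<xi> j = 0"
    and L0: "\<And>a'. a' < card A \<Longrightarrow> L a' \<xi> = 0"
    using underdetermined_system[of "card A" L "insert None (Some ` A)"] assms(1) by blast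
  have "\<xi> None \<noteq> 0"
  proof
    assume "\<xi> None = 0"
    then have "(\<Sum>i\<in>A. \<xi> (Some i) * t i ^ a') = 0" if "a' < card A" for a'
      using L0[OF that] by (simp add: L_def)
    then have "\<xi> (Some i) = 0" if "i \<in> A" for i
      using vandermonde_independent[OF assms(1,2), of "\<lambda>i. \<xi> (Some i)"] that by blast
    then have "\<xi> j = 0" for j
      using \<xi>(2)[of j] \<open>\<xi> None = 0\<close> by (cases j) auto
    with \<xi>(1) show False by blast
  qed
  moreover have "(\<Sum>i\<in>A. (\<xi> (Some i) / \<xi> None) * t i ^ a') = (if a' = a then \<xi> None else 0) / \<xi> None"
    if "a' < card A" for a'
  proof -
    have "(\<Sum>i\<in>A. (\<xi> (Some i) / \<xi> None) * t i ^ a') = (\<Sum>i\<in>A. \<xi> (Some i) * t i ^ a') / \<xi> None"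
      by (simp add: sum_divide_distrib)
    then show ?thesis
      using L0[OF that] by (simp add: L_def)
  qed
  ultimately show ?thesis
    by (intro exI[of _ "\<lambda>i. \<xi> (Some i) / \<xi> None"]) auto
qed

text \<open>These are the reciprocals of the nonzero eigenvalues of \<open>Y\<close>. More than
  \<open>card \<Omega>\<close> eigenvectors satisfy a linear relation; applying \<open>Y\<close>
  repeatedly multiplies its terms by powers of the distinct numbers \<open>inverse \<sigma>\<close>,
  so by Vandermonde every single term vanishes.\<close>

lemma finite_eigenvalues:
  fixes Y :: "'w \<Rightarrow> 'w \<Rightarrow> complex"
  assumes "finite \<Omega>"
  shows "finite {\<sigma>. \<exists>v. (\<exists>\<omega>\<in>\<Omega>. v \<omega> \<noteq> 0) \<and> (\<forall>\<omega>\<in>\<Omega>. v \<omega> = \<sigma> * (\<Sum>\<omega>'\<in>\<Omega>. Y \<omega> \<omega>' * v \<omega>'))}"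
    (is "finite ?S")
proof (rule ccontr)
  assume "infinite ?S"
  then obtain T where T: "T \<subseteq> ?S" "finite T" "card T = Suc (card \<Omega>)"
    using infinite_arbitrarily_large by blast
  then obtain v where v: "\<And>\<sigma>. \<sigma> \<in> T \<Longrightarrow> \<exists>\<omega>\<in>\<Omega>. v \<sigma> \<omega> \<noteq> 0"
    "\<And>\<sigma> \<omega>. \<sigma> \<in> T \<Longrightarrow> \<omega> \<in> \<Omega> \<Longrightarrow> v \<sigma> \<omega> = \<sigma> * (\<Sum>\<omega>'\<in>\<Omega>. Y \<omega> \<omega>' * v \<sigma> \<omega>')"
    unfolding subset_iff mem_Collect_eq by metis
  have Yv: "(\<Sum>\<omega>'\<in>\<Omega>. Y \<omega> \<omega>' * v \<sigma> \<omega>') = inverse \<sigma> * v \<sigma> \<omega>" if "\<sigma> \<in> T" "\<omega> \<in> \<Omega>" for \<sigma> \<omega>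
    using v(2)[OF that] v(1)[OF that(1)] v(2)[OF that(1)] by (cases "\<sigma> = 0") (auto simp: field_simps)
  obtain e where e: "bij_betw e {..<card \<Omega>} \<Omega>"
    using ex_bij_betw_nat_finite[OF assms] by (auto simp: atLeast0LessThan)
  have lin: "(\<Sum>\<sigma>\<in>T. (a * \<xi> \<sigma> + b * \<zeta> \<sigma>) * v \<sigma> \<omega>)
      = a * (\<Sum>\<sigma>\<in>T. \<xi> \<sigma> * v \<sigma> \<omega>) + b * (\<Sum>\<sigma>\<in>T. \<zeta> \<sigma> * v \<sigma> \<omega>)" for a b \<xi> \<zeta> \<omega>
    by (simp add: sum.distrib sum_distrib_left algebra_simps)
  obtain \<xi> where \<xi>: "\<exists>\<sigma>. \<xi> \<sigma> \<noteq> 0" "\<And>\<sigma>. \<sigma> \<notin> T \<Longrightarrow> \<xi> \<sigma> = 0"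
    "\<And>i. i < card \<Omega> \<Longrightarrow> (\<Sum>\<sigma>\<in>T. \<xi> \<sigma> * v \<sigma> (e i)) = 0"
    using underdetermined_system[of "card \<Omega>" "\<lambda>i \<xi>. \<Sum>\<sigma>\<in>T. \<xi> \<sigma> * v \<sigma> (e i)" T, OF lin] T(2,3)
    by auto
  have pow: "(\<Sum>\<sigma>\<in>T. (\<xi> \<sigma> * v \<sigma> \<omega>) * inverse \<sigma> ^ a) = 0" if "\<omega> \<in> \<Omega>" for a \<omega>
    using that
  proof (induction a arbitrary: \<omega>)
    case 0
    then obtain i where "i < card \<Omega>" "\<omega> = e i"
      using e unfolding bij_betw_def by auto
    then show ?case using \<xi>(3) by simp
  next
    case (Suc a)
    have "(\<Sum>\<sigma>\<in>T. (\<xi> \<sigma> * v \<sigma> \<omega>) * inverse \<sigma> ^ Suc a)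
        = (\<Sum>\<sigma>\<in>T. \<Sum>\<omega>'\<in>\<Omega>. Y \<omega> \<omega>' * ((\<xi> \<sigma> * v \<sigma> \<omega>') * inverse \<sigma> ^ a))"
    proof (rule sum.cong)
      fix \<sigma> assume "\<sigma> \<in> T"
      have "(\<xi> \<sigma> * v \<sigma> \<omega>) * inverse \<sigma> ^ Suc a = \<xi> \<sigma> * inverse \<sigma> ^ a * (inverse \<sigma> * v \<sigma> \<omega>)"
        by simp
      also have "\<dots> = \<xi> \<sigma> * inverse \<sigma> ^ a * (\<Sum>\<omega>'\<in>\<Omega>. Y \<omega> \<omega>' * v \<sigma> \<omega>')"
        using Yv[OF \<open>\<sigma> \<in> T\<close> Suc.prems] by simp
      finally show "(\<xi> \<sigma> * v \<sigma> \<omega>) * inverse \<sigma> ^ Suc a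
          = (\<Sum>\<omega>'\<in>\<Omega>. Y \<omega> \<omega>' * ((\<xi> \<sigma> * v \<sigma> \<omega>') * inverse \<sigma> ^ a))"
        by (simp add: sum_distrib_left mult_ac)
    qed simp
    also have "\<dots> = (\<Sum>\<omega>'\<in>\<Omega>. Y \<omega> \<omega>' * (\<Sum>\<sigma>\<in>T. (\<xi> \<sigma> * v \<sigma> \<omega>') * inverse \<sigma> ^ a))"
      by (subst sum.swap) (simp add: sum_distrib_left)
    also have "\<dots> = 0"
      using Suc.IH by simp
    finally show ?case .
  qed
  have "\<xi> \<sigma> * v \<sigma> \<omega> = 0" if "\<sigma> \<in> T" "\<omega> \<in> \<Omega>" for \<sigma> \<omega>
    using vandermonde_independent[OF T(2), of inverse "\<lambda>\<sigma>. \<xi> \<sigma> * v \<sigma> \<omega>"] pow that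
    by (auto simp: inj_on_def)
  with \<xi>(1,2) v(1) show False
    by (metis mult_eq_0_iff)
qed

section \<open>Spans of complex-valued functions\<close>

text \<open>Spans grow by one generator at a time, so that induction carries over whatever is linear
  in the generators: pointwise products, weighted evaluations, the replacement of one system by
  another.\<close>

inductive_set cspan :: "('z \<Rightarrow> complex) set \<Rightarrow> ('z \<Rightarrow> complex) set"
  for S :: "('z \<Rightarrow> complex) set"
  where
    zero: "(\<lambda>z. 0) \<in> cspan S"
  | step: "g \<in> S \<Longrightarrow> f \<in> cspan S \<Longrightarrow> (\<lambda>z. c * g z + f z) \<in> cspan S"

lemma cspan_base: "g \<in> S \<Longrightarrow> g \<in> cspan S"
  using cspan.step[OF _ cspan.zero, of g S 1] by simp

lemma cspan_add:
  assumes "f \<in> cspan S" "g \<in> cspan S"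
  shows "(\<lambda>z. f z + g z) \<in> cspan S"
  using assms(1)
proof induction
  case (step h f c)
  then show ?case
    using cspan.step[of h S "\<lambda>z. f z + g z" c] by (simp add: add.assoc)
qed (use assms(2) in simp)

lemma cspan_scale:
  assumes "f \<in> cspan S"
  shows "(\<lambda>z. c * f z) \<in> cspan S"
  using assms
proof induction
  case (step h f a)
  then show ?case
    using cspan.step[of h S "\<lambda>z. c * f z" "c * a"] by (simp add: algebra_simps)
qed (simp add: cspan.zero)

lemma cspan_sum:
  assumes "\<And>i. i \<in> I \<Longrightarrow> f i \<in> cspan S"
  shows "(\<lambda>z. \<Sum>i\<in>I. c i * f i z) \<in> cspan S"
  using assms
  by (induction I rule: infinite_finite_induct)
    (auto simp: cspan.zero intro!: cspan_add[of "\<lambda>z. _ * _ z"] cspan_scale)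

lemma cspan_subset:
  assumes "f \<in> cspan S" "\<And>g. g \<in> S \<Longrightarrow> g \<in> cspan T"
  shows "f \<in> cspan T"
  using assms(1)
proof induction
  case (step g f c)
  then show ?case
    using cspan_add[OF cspan_scale[OF assms(2)]] by blast
qed (rule cspan.zero)

lemma cspan_mono: "f \<in> cspan S \<Longrightarrow> S \<subseteq> T \<Longrightarrow> f \<in> cspan T"
  by (erule cspan_subset) (auto intro: cspan_base)

lemma cspan_mult_left:
  assumes "f \<in> cspan S" "\<And>g. g \<in> S \<Longrightarrow> (\<lambda>z. h z * g z) \<in> cspan T"
  shows "(\<lambda>z. h z * f z) \<in> cspan T"
  using assms(1)
proof induction
  case (step g f c)
  have "(\<lambda>z. c * (h z * g z) + h z * f z) \<in> cspan T"
    by (intro cspan_add[of "\<lambda>z. c * (h z * g z)"] cspan_scale[of "\<lambda>z. h z * g z"] step assms(2))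
  then show ?case
    by (simp add: algebra_simps)
qed (simp add: cspan.zero)

lemma cspan_finite:
  assumes "f \<in> cspan S" "finite S"
  shows "\<exists>c. f = (\<lambda>z. \<Sum>g\<in>S. c g * g z)"
  using assms(1)
proof induction
  case zero
  show ?case by (intro exI[of _ "\<lambda>_. 0"]) simp
next
  case (step g f a)
  then obtain c where f: "f = (\<lambda>z. \<Sum>g\<in>S. c g * g z)" by blast
  have "(\<Sum>h\<in>S. (c h + (if h = g then a else 0)) * h z) = a * g z + f z" for z
  proof -
    have "(\<Sum>h\<in>S. (c h + (if h = g then a else 0)) * h z)
        = (\<Sum>h\<in>S. c h * h z) + (\<Sum>h\<in>S. if h = g then a * h z else 0)"
      by (simp add: distrib_right flip: sum.distrib) (auto intro!: sum.cong)
    then show ?thesis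
      using assms(2) step.hyps by (simp add: f)
  qed
  then show ?case
    by (intro exI[of _ "\<lambda>h. c h + (if h = g then a else 0)"]) simp
qed

section \<open>Bihomogeneous forms and products of linear forms in general position\<close>

text \<open>
  A point \<open>z :: nat + nat \<Rightarrow> complex\<close> has homogeneous parameters \<open>z (Inl 0), \<dots>, z (Inl k)\<close>, where the
  affine chart is \<open>z (Inl k) = 1\<close>, and vector entries \<open>z (Inr 0), \<dots>, z (Inr (n - 1))\<close>.
\<close>

fun monomials :: "nat \<Rightarrow> nat \<Rightarrow> ((nat + nat \<Rightarrow> complex) \<Rightarrow> complex) set" where
  "monomials k 0 = {\<lambda>z. 1}"
| "monomials k (Suc d) = (\<lambda>(a, p) z. z (Inl a) * p z) ` ({..<Suc k} \<times> monomials k d)"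

definition vec_monomials :: "nat \<Rightarrow> nat \<Rightarrow> nat \<Rightarrow> ((nat + nat \<Rightarrow> complex) \<Rightarrow> complex) set"
  where "vec_monomials k n d = (\<lambda>(p, b) z. p z * z (Inr b)) ` (monomials k d \<times> {..<n})"

text \<open>The coefficients lie on the moment curve. By Vandermonde any \<open>k + 1\<close> of
  these forms with distinct indices are linearly independent, and so are any \<open>k\<close> of
  them together with \<open>z (Inl k)\<close>. The same holds for \<open>hform\<close> with
  \<open>n\<close> forms, or \<open>n - 1\<close> forms and the last entry.\<close>

definition lform :: "nat \<Rightarrow> nat \<Rightarrow> (nat + nat \<Rightarrow> complex) \<Rightarrow> complex"
  where "lform k i z = (\<Sum>a<Suc k. of_nat i ^ a * z (Inl a))"

definition hform :: "nat \<Rightarrow> nat \<Rightarrow> (nat + nat \<Rightarrow> complex) \<Rightarrow> complex"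
  where "hform n i z = (\<Sum>b<n. of_nat i ^ b * z (Inr b))"

lemma finite_monomials: "finite (monomials k d)"
  by (induction d) auto

lemma finite_vec_monomials: "finite (vec_monomials k n d)"
  unfolding vec_monomials_def by (intro finite_imageI finite_cartesian_product finite_monomials) simp

lemma monomials_SucI: "a \<le> k \<Longrightarrow> p \<in> monomials k d \<Longrightarrow> (\<lambda>z. z (Inl a) * p z) \<in> monomials k (Suc d)"
  by force

lemma monomials_SucE:
  assumes "w \<in> monomials k (Suc d)"
  obtains a p where "a \<le> k" "p \<in> monomials k d" "w = (\<lambda>z. z (Inl a) * p z)"
  using assms by (auto simp: less_Suc_eq_le)

lemma vec_monomialsI: "p \<in> monomials k d \<Longrightarrow> b < n \<Longrightarrow> (\<lambda>z. p z * z (Inr b)) \<in> vec_monomials k n d"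
  unfolding vec_monomials_def by force

lemma vec_monomialsE:
  assumes "w \<in> vec_monomials k n d"
  obtains p b where "p \<in> monomials k d" "b < n" "w = (\<lambda>z. p z * z (Inr b))"
  using assms unfolding vec_monomials_def by force

lemma lform_mult_monomial:
  assumes "p \<in> monomials k d"
  shows "(\<lambda>z. lform k i z * p z) \<in> cspan (monomials k (Suc d))"
proof -
  have "(\<lambda>z. \<Sum>a<Suc k. of_nat i ^ a * (z (Inl a) * p z)) \<in> cspan (monomials k (Suc d))"
    by (intro cspan_sum[where f = "\<lambda>a z. z (Inl a) * p z"] cspan_base monomials_SucI assms) auto
  then show ?thesis
    by (simp only: lform_def sum_distrib_right mult.assoc)
qed

lemma lform_mult_vec_monomial:
  assumes "w \<in> vec_monomials k n d"
  shows "(\<lambda>z. lform k i z * w z) \<in> cspan (vec_monomials k n (Suc d))"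
proof -
  obtain p b where w: "p \<in> monomials k d" "b < n" "w = (\<lambda>z. p z * z (Inr b))"
    using vec_monomialsE[OF assms] .
  have "(\<lambda>z. z (Inr b) * (lform k i z * p z)) \<in> cspan (vec_monomials k n (Suc d))"
  proof (rule cspan_mult_left[OF lform_mult_monomial[OF w(1)]])
    fix g assume "g \<in> monomials k (Suc d)"
    then show "(\<lambda>z. z (Inr b) * g z) \<in> cspan (vec_monomials k n (Suc d))"
      using vec_monomialsI[OF _ w(2)] by (subst mult.commute) (rule cspan_base)
  qed
  then show ?thesis
    by (simp add: w mult_ac)
qed

section \<open>Spanning by forms in general position\<close>

lemma moment_forms_span:
  fixes u :: "nat \<Rightarrow> 'z \<Rightarrow> complex" and K :: nat
  defines "v \<equiv> (\<lambda>i z. \<Sum>a<K. of_nat i ^ a * u a z)"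
  assumes "finite A" "K \<le> card A" "a < K"
  shows "u a \<in> cspan (v ` A)"
proof -
  obtain A0 where A0: "A0 \<subseteq> A" "card A0 = K" "finite A0"
    using obtain_subset_with_card_n[OF assms(3)] by blast
  have "\<exists>c. \<forall>a'<K. (\<Sum>i\<in>A0. c i * of_nat i ^ a') = (if a' = a then 1 else 0 :: complex)"
    using vandermonde_dual_basis[OF A0(3) inj_on_of_nat, of a] assms(4) unfolding A0(2) .
  then obtain c :: "nat \<Rightarrow> complex"
    where c: "\<forall>a'<K. (\<Sum>i\<in>A0. c i * of_nat i ^ a') = (if a' = a then 1 else 0)" ..
  have "(\<Sum>i\<in>A0. c i * v i z) = u a z" for z
  proof -
    have "(\<Sum>i\<in>A0. c i * v i z) = (\<Sum>a'<K. (\<Sum>i\<in>A0. c i * of_nat i ^ a') * u a' z)"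
      unfolding v_def sum_distrib_left sum_distrib_right by (subst sum.swap) (simp add: mult_ac)
    also have "\<dots> = (\<Sum>a'<K. if a' = a then u a' z else 0)"
      by (intro sum.cong) (auto simp: c)
    finally show ?thesis
      using assms(4) by simp
  qed
  moreover have "(\<lambda>z. \<Sum>i\<in>A0. c i * v i z) \<in> cspan (v ` A)"
    using A0 by (intro cspan_sum cspan_base) auto
  ultimately show ?thesis by simp
qed

text \<open>Dual weights for the first \<open>K\<close> powers isolate \<open>u a\<close> up to a
  multiple of \<open>u K\<close>. Geometrically, the point where \<open>K\<close> of the forms
  vanish lies off the hyperplane \<open>u K = 0\<close>.\<close>

lemma moment_forms_span_last:
  fixes u :: "nat \<Rightarrow> 'z \<Rightarrow> complex" and K :: nat
  defines "v \<equiv> (\<lambda>i z. \<Sum>a<Suc K. of_nat i ^ a * u a z)"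
  assumes "finite A" "card A = K" "a \<le> K"
  shows "u a \<in> cspan (insert (u K) (v ` A))"
proof (cases "a = K")
  case False
  then have "a < K" using assms by simp
  then have "\<exists>c. \<forall>a'<K. (\<Sum>i\<in>A. c i * of_nat i ^ a') = (if a' = a then 1 else 0 :: complex)"
    using vandermonde_dual_basis[OF assms(2) inj_on_of_nat, of a] unfolding assms(3) by blast
  then obtain c :: "nat \<Rightarrow> complex"
    where c: "\<forall>a'<K. (\<Sum>i\<in>A. c i * of_nat i ^ a') = (if a' = a then 1 else 0)" ..
  define e where "e = (\<Sum>i\<in>A. c i * of_nat i ^ K)"
  have "(- e) * u K z + (\<Sum>i\<in>A. c i * v i z) = u a z" for z
  proof -
    have "(\<Sum>i\<in>A. c i * v i z) = (\<Sum>a'<Suc K. (\<Sum>i\<in>A. c i * of_nat i ^ a') * u a' z)"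
      unfolding v_def sum_distrib_left sum_distrib_right by (subst sum.swap) (simp add: mult_ac)
    also have "\<dots> = (\<Sum>a'<K. if a' = a then u a' z else 0) + e * u K z"
      unfolding sum.lessThan_Suc e_def by (intro arg_cong2[of _ _ _ _ "(+)"] sum.cong) (auto simp: c)
    finally show ?thesis
      using \<open>a < K\<close> by simp
  qed
  moreover have "(\<lambda>z. (- e) * u K z + (\<Sum>i\<in>A. c i * v i z)) \<in> cspan (insert (u K) (v ` A))"
    by (intro cspan.step cspan_sum cspan_base) auto
  ultimately show ?thesis by simp
qed (auto intro: cspan_base)

lemma lform_span:
  assumes "finite A" "Suc k \<le> card A" "a \<le> k"
  shows "(\<lambda>z. z (Inl a)) \<in> cspan (lform k ` A)"
  using moment_forms_span[of A "Suc k" a "\<lambda>a z. z (Inl a)"] assms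
  unfolding lform_def[abs_def] by simp

lemma hform_span:
  assumes "finite A" "n \<le> card A" "b < n"
  shows "(\<lambda>z. z (Inr b)) \<in> cspan (hform n ` A)"
  using moment_forms_span[of A n b "\<lambda>b z. z (Inr b)"] assms
  unfolding hform_def[abs_def] by simp

lemma lform_span_last:
  assumes "finite A" "card A = k" "a \<le> k"
  shows "(\<lambda>z. z (Inl a)) \<in> cspan (insert (\<lambda>z. z (Inl k)) (lform k ` A))"
  using moment_forms_span_last[of A k a "\<lambda>a z. z (Inl a)"] assms
  unfolding lform_def[abs_def] by simp

lemma hform_span_last:
  assumes "finite A" "Suc (card A) = n" "b < n"
  shows "(\<lambda>z. z (Inr b)) \<in> cspan (insert (\<lambda>z. z (Inr (n - 1))) (hform n ` A))"
proof -
  have "card A = n - 1" "Suc (n - 1) = n" "b \<le> n - 1"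
    using assms by simp_all
  then show ?thesis
    using moment_forms_span_last[of A "n - 1" b "\<lambda>b z. z (Inr b)"] assms(1)
    unfolding hform_def[abs_def] by (simp del: sum.lessThan_Suc)
qed

text \<open>The \<open>k\<close> forms have one common projective zero, whose last coordinate is
  nonzero; modulo them only the power of \<open>z (Inl k)\<close> survives. The condition
  \<open>d > 0\<close> excludes multiples of the forms in degree \<open>0\<close>, where
  \<open>d - 1\<close> is truncated.\<close>

lemma monomial_mod_lforms:
  assumes "finite A" "card A = k" "p \<in> monomials k d"
  shows "p \<in> cspan (insert (\<lambda>z. z (Inl k) ^ d) {\<lambda>z. lform k i z * q z | i q. i \<in> A \<and> d > 0 \<and> q \<in> monomials k (d - 1)})"
  using assms(3)
proof (induction d arbitrary: p)
  case 0
  then show ?case by (auto intro!: cspan_base)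
next
  case (Suc d)
  let ?S = "\<lambda>d. insert (\<lambda>z. z (Inl k) ^ d)
    {\<lambda>z. lform k i z * q z | i q. i \<in> A \<and> d > 0 \<and> q \<in> monomials k (d - 1)}"
  obtain a p' where p: "a \<le> k" "p' \<in> monomials k d" "p = (\<lambda>z. z (Inl a) * p' z)"
    using Suc.prems by (rule monomials_SucE)
  have "(\<lambda>z. z (Inl k) * p' z) \<in> cspan (?S (Suc d))"
  proof (rule cspan_mult_left[OF Suc.IH[OF p(2)]])
    fix g assume g: "g \<in> ?S d"
    show "(\<lambda>z. z (Inl k) * g z) \<in> cspan (?S (Suc d))"
      using g
    proof
      assume "g = (\<lambda>z. z (Inl k) ^ d)"
      then show ?thesis by (auto intro: cspan_base)
    next
      assume "g \<in> {\<lambda>z. lform k i z * q z | i q. i \<in> A \<and> d > 0 \<and> q \<in> monomials k (d - 1)}"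
      then obtain i q where "i \<in> A" "d > 0" "q \<in> monomials k (d - 1)" "g = (\<lambda>z. lform k i z * q z)"
        by blast
      moreover have "(\<lambda>z. z (Inl k) * q z) \<in> monomials k d"
        using monomials_SucI[of k k q "d - 1"] calculation by simp
      ultimately show ?thesis
        by (intro cspan_base) (auto simp: mult_ac intro!: exI[of _ i] exI[of _ "\<lambda>z. z (Inl k) * q z"])
    qed
  qed
  then have *: "(\<lambda>z. p' z * z (Inl k)) \<in> cspan (?S (Suc d))"
    by (simp add: mult.commute)
  have "(\<lambda>z. p' z * z (Inl a)) \<in> cspan (?S (Suc d))"
  proof (rule cspan_mult_left[OF lform_span_last[OF assms(1,2) p(1)]])
    fix g assume "g \<in> insert (\<lambda>z. z (Inl k)) (lform k ` A)"
    then consider "g = (\<lambda>z. z (Inl k))" | i where "i \<in> A" "g = lform k i"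
      by blast
    then show "(\<lambda>z. p' z * g z) \<in> cspan (?S (Suc d))"
    proof cases
      case 2
      then have "(\<lambda>z. lform k i z * p' z) \<in> ?S (Suc d)"
        using p(2) by auto
      then show ?thesis
        unfolding 2(2) by (subst mult.commute) (rule cspan_base)
    qed (use * in simp)
  qed
  then show ?case
    by (simp add: p mult.commute)
qed

text \<open>
  Modulo the products \<open>lform i * hform i\<close> with \<open>i \<ge> j\<close>, the forms \<open>lform i\<close> with \<open>i \<in> A\<close> and the forms
  \<open>hform i\<close> with \<open>i < j\<close> and \<open>i \<notin> A\<close>, the last family spans everything. It has one member for each of
  the points of general position in which \<open>k\<close> parameter forms and the complementary \<open>n - 1\<close> vector
  forms vanish.
\<close>

definition mixed_gens :: "nat \<Rightarrow> nat \<Rightarrow> nat \<Rightarrow> nat \<Rightarrow> nat set \<Rightarrow> nat \<Rightarrow> ((nat + nat \<Rightarrow> complex) \<Rightarrow> complex) set"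
  where "mixed_gens k n N j A d =
    {\<lambda>z. lform k i z * w z | i w. i \<in> A \<and> w \<in> vec_monomials k n (d - 1)} \<union>
    {\<lambda>z. hform n i z * p z | i p. i < j \<and> i \<notin> A \<and> p \<in> monomials k d} \<union>
    {\<lambda>z. lform k i z * hform n i z * q z | i q. j \<le> i \<and> i < N \<and> q \<in> monomials k (d - 1)} \<union>
    {\<lambda>z. (\<Prod>i\<in>{j..<N} - T. lform k i z) * z (Inl k) ^ (d - card ({j..<N} - T)) * z (Inr (n - 1)) | T.
      T \<subseteq> {..<N} \<and> card T = k \<and> T \<inter> {..<j} = A}"

lemma mixed_gens_lform:
  "i \<in> A \<Longrightarrow> w \<in> cspan (vec_monomials k n (d - 1)) \<Longrightarrow> (\<lambda>z. lform k i z * w z) \<in> cspan (mixed_gens k n N j A d)"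
  by (erule cspan_mult_left, rule cspan_base) (auto simp: mixed_gens_def)

lemma mixed_gens_hform:
  "i < j \<Longrightarrow> i \<notin> A \<Longrightarrow> p \<in> cspan (monomials k d) \<Longrightarrow> (\<lambda>z. hform n i z * p z) \<in> cspan (mixed_gens k n N j A d)"
  by (erule cspan_mult_left, rule cspan_base) (auto simp: mixed_gens_def)

lemma mixed_gens_product:
  assumes "j \<le> i" "i < N" "q \<in> cspan (monomials k (d - 1))"
  shows "(\<lambda>z. lform k i z * hform n i z * q z) \<in> cspan (mixed_gens k n N j A d)"
  using assms(3) by (rule cspan_mult_left) (rule cspan_base, use assms(1,2) in \<open>auto simp: mixed_gens_def\<close>)

lemma mixed_gens_point:
  assumes "T \<subseteq> {..<N}" "card T = k" "T \<inter> {..<j} = A"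
  shows "(\<lambda>z. (\<Prod>i\<in>{j..<N} - T. lform k i z) * z (Inl k) ^ (d - card ({j..<N} - T)) * z (Inr (n - 1)))
    \<in> cspan (mixed_gens k n N j A d)"
  by (rule cspan_base) (use assms in \<open>auto simp: mixed_gens_def\<close>)

lemma mixed_gens_cases:
  assumes "g \<in> mixed_gens k n N j A d"
  obtains
    (lform) i w where "i \<in> A" "w \<in> vec_monomials k n (d - 1)" "g = (\<lambda>z. lform k i z * w z)"
  | (hform) i p where "i < j" "i \<notin> A" "p \<in> monomials k d" "g = (\<lambda>z. hform n i z * p z)"
  | (prod) i q where "j \<le> i" "i < N" "q \<in> monomials k (d - 1)"
      "g = (\<lambda>z. lform k i z * hform n i z * q z)"
  | (point) T where "T \<subseteq> {..<N}" "card T = k" "T \<inter> {..<j} = A"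
      "g = (\<lambda>z. (\<Prod>i\<in>{j..<N} - T. lform k i z) * z (Inl k) ^ (d - card ({j..<N} - T)) * z (Inr (n - 1)))"
  using assms unfolding mixed_gens_def Un_iff mem_Collect_eq by blast

text \<open>All \<open>N = n + k - 1\<close> indices are decided. With more than \<open>k\<close> of
  them in \<open>A\<close> the parameter forms generate every parameter; with fewer, at least
  \<open>n\<close> vector forms remain and generate every vector entry. Only for
  \<open>card A = k\<close> does a class survive, that of the single point with
  \<open>T = A\<close>.\<close>

lemma vec_monomials_mixed_gens_final:
  assumes "Suc N = n + k" "A \<subseteq> {..<N}" "d > 0" "f \<in> vec_monomials k n d"
  shows "f \<in> cspan (mixed_gens k n N N A d)"
proof -
  let ?G = "cspan (mixed_gens k n N N A d)"
  have fin: "finite A"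
    using assms(2) finite_subset by blast
  define B where "B = {..<N} - A"
  have B: "finite B" "card B + card A = N"
    using fin assms(2) card_mono[OF _ assms(2)] by (auto simp: B_def card_Diff_subset)
  obtain p b where f: "p \<in> monomials k d" "b < n" "f = (\<lambda>z. p z * z (Inr b))"
    using vec_monomialsE[OF assms(4)] .
  consider "card A > k" | "card A < k" | "card A = k"
    by linarith
  then show ?thesis
  proof cases
    case 1
    obtain a q where p: "a \<le> k" "q \<in> monomials k (d - 1)" "p = (\<lambda>z. z (Inl a) * q z)"
      using monomials_SucE[of p k "d - 1"] f(1) assms(3) by auto
    have "(\<lambda>z. (q z * z (Inr b)) * z (Inl a)) \<in> ?G"
    proof (rule cspan_mult_left[OF lform_span[OF fin _ p(1)]])
      fix g assume "g \<in> lform k ` A"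
      then show "(\<lambda>z. (q z * z (Inr b)) * g z) \<in> ?G"
        using mixed_gens_lform[OF _ cspan_base[OF vec_monomialsI[OF p(2) f(2)]]]
        by (auto simp: mult.commute)
    qed (use 1 in simp)
    then show ?thesis
      by (simp add: f p mult_ac)
  next
    case 2
    show ?thesis
      unfolding f(3)
    proof (rule cspan_mult_left[OF hform_span[OF B(1) _ f(2)]])
      fix g assume "g \<in> hform n ` B"
      then show "(\<lambda>z. p z * g z) \<in> ?G"
        using mixed_gens_hform[OF _ _ cspan_base[OF f(1)]] by (auto simp: B_def mult.commute)
    qed (use 2 B assms(1) in simp)
  next
    case 3
    have last: "(\<lambda>z. z (Inr (n - 1)) * p z) \<in> ?G"
    proof (rule cspan_mult_left[OF monomial_mod_lforms[OF fin 3 f(1)]])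
      fix g assume "g \<in> insert (\<lambda>z. z (Inl k) ^ d)
        {\<lambda>z. lform k i z * q z | i q. i \<in> A \<and> 0 < d \<and> q \<in> monomials k (d - 1)}"
      then consider "g = (\<lambda>z. z (Inl k) ^ d)"
        | i q where "i \<in> A" "q \<in> monomials k (d - 1)" "g = (\<lambda>z. lform k i z * q z)"
        by blast
      then show "(\<lambda>z. z (Inr (n - 1)) * g z) \<in> ?G"
      proof cases
        case 1
        then show ?thesis
          using mixed_gens_point[of A N k N A d n] assms(2) 3 by (simp add: Int_absorb2 mult.commute)
      next
        case (2 i q)
        have "(\<lambda>z. lform k i z * (q z * z (Inr (n - 1)))) \<in> ?G"
          using f(2) by (intro mixed_gens_lform[OF 2(1)] cspan_base vec_monomialsI 2(2)) simp
        then show ?thesis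
          by (simp add: 2(3) mult_ac)
      qed
    qed
    show ?thesis
      unfolding f(3)
    proof (rule cspan_mult_left[OF hform_span_last[OF B(1) _ f(2)]])
      fix g assume "g \<in> insert (\<lambda>z. z (Inr (n - 1))) (hform n ` B)"
      then show "(\<lambda>z. p z * g z) \<in> ?G"
        using mixed_gens_hform[OF _ _ cspan_base[OF f(1)]] last by (auto simp: B_def mult.commute)
    qed (use 3 B assms(1) in simp)
  qed
qed

text \<open>Index \<open>j\<close> is decided in both ways. Adding it to \<open>A\<close> leaves
  multiples \<open>lform k j * w\<close> to be treated; then \<open>w\<close>, of degree
  \<open>d - 1\<close>, is reduced with \<open>j\<close> on the vector side, and the factor turns
  multiples of \<open>hform n j\<close> into multiples of the product of both forms. Such a step
  costs one degree, whence \<open>N < j + d\<close>.\<close>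

lemma vec_monomials_mixed_gens:
  assumes "Suc N = n + k" "j \<le> N" "A \<subseteq> {..<j}" "N < j + d" "f \<in> vec_monomials k n d"
  shows "f \<in> cspan (mixed_gens k n N j A d)"
  using assms(2-)
proof (induction j arbitrary: A d f rule: inc_induct)
  case base
  then show ?case
    using vec_monomials_mixed_gens_final[OF assms(1)] by simp
next
  case (step j)
  have "d > 1"
    using step by simp
  then obtain e where d: "d = Suc (Suc e)"
    by (metis One_nat_def less_imp_Suc_add plus_nat.simps(2))
  have jA: "j \<notin> A"
    using step.prems by auto
  show ?case
  proof (rule cspan_subset[OF step.IH])
    show "insert j A \<subseteq> {..<Suc j}" "N < Suc j + d" "f \<in> vec_monomials k n d"
      using step.prems by auto
    fix g assume "g \<in> mixed_gens k n N (Suc j) (insert j A) d"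
    then show "g \<in> cspan (mixed_gens k n N j A d)"
    proof (cases rule: mixed_gens_cases)
      case (lform i w)
      show ?thesis
      proof (cases "i = j")
        case False
        then show ?thesis
          using lform mixed_gens_lform[OF _ cspan_base] by simp
      next
        case True
        have "w \<in> cspan (mixed_gens k n N (Suc j) A (d - 1))"
          using step.prems lform d by (intro step.IH) auto
        then have "(\<lambda>z. lform k j z * w z) \<in> cspan (mixed_gens k n N j A d)"
        proof (rule cspan_mult_left)
          fix h assume "h \<in> mixed_gens k n N (Suc j) A (d - 1)"
          then show "(\<lambda>z. lform k j z * h z) \<in> cspan (mixed_gens k n N j A d)"
          proof (cases rule: mixed_gens_cases)
            case (lform i v)
            then show ?thesis
              using mixed_gens_lform[OF lform(1), of "\<lambda>z. lform k j z * v z" k n d N j]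
                lform_mult_vec_monomial[of v k n e j]
              by (simp add: mult.left_commute d)
          next
            case (hform i p)
            show ?thesis
            proof (cases "i = j")
              case True
              then show ?thesis
                using hform mixed_gens_product[of j j N p k d n A] step.hyps
                by (simp add: cspan_base mult.assoc)
            next
              case False
              then show ?thesis
                using hform mixed_gens_hform[of i j A "\<lambda>z. lform k j z * p z" k d n N]
                  lform_mult_monomial[of p k "Suc e" j]
                by (simp add: mult.left_commute d)
            qed
          next
            case (prod i q)
            then show ?thesis
              using mixed_gens_product[of j i N "\<lambda>z. lform k j z * q z" k d n A]
                lform_mult_monomial[of q k e j]
              by (simp add: mult_ac d)
          next
            case (point T)
            have "j \<notin> T"
              using point(3) jA by auto
            \<comment> \<open>The point class gains the factor \<open>lform k j\<close> while the
              degree rises from \<open>d - 1\<close> to \<open>d\<close>, so the exponent of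
              \<open>z (Inl k)\<close> is unchanged.\<close>
            then have "{j..<N} - T = insert j ({Suc j..<N} - T)"
              using step.hyps by auto
            moreover have "T \<inter> {..<j} = A"
              using point(3) \<open>j \<notin> T\<close> by (auto simp: less_Suc_eq lessThan_Suc)
            ultimately show ?thesis
              using mixed_gens_point[OF point(1,2), of j A d n] by (simp add: point(4) mult_ac)
          qed
        qed
        then show ?thesis
          by (simp add: lform True)
      qed
    next
      case (hform i p)
      then show ?thesis
        using mixed_gens_hform[of i j A p k d n N] by (simp add: cspan_base less_Suc_eq)
    next
      case (prod i q)
      then show ?thesis
        using mixed_gens_product[of j i N q k d n A] by (simp add: cspan_base)
    next
      case (point T)
      have "j \<in> T"
        using point(3) by blast
      then have "{j..<N} - T = {Suc j..<N} - T"
        by (auto simp: Suc_le_eq le_less)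
      moreover have "T \<inter> {..<j} = A"
        using point(3) jA by (auto simp: lessThan_Suc)
      ultimately show ?thesis
        using mixed_gens_point[OF point(1,2), of j A d n] by (simp add: point(4))
    qed
  qed
qed

section \<open>Deformation along the line and zeros of its general members\<close>

definition biform :: "nat \<Rightarrow> nat \<Rightarrow> (nat \<Rightarrow> nat \<Rightarrow> complex) \<Rightarrow> (nat + nat \<Rightarrow> complex) \<Rightarrow> complex"
  where "biform k n c z = (\<Sum>a<Suc k. \<Sum>b<n. c a b * z (Inl a) * z (Inr b))"

lemma biform_product: "biform k n (\<lambda>a b. of_nat i ^ a * of_nat i ^ b) z = lform k i z * hform n i z"
  unfolding biform_def lform_def hform_def sum_product by (simp add: mult_ac del: sum.lessThan_Suc)

lemma biform_linear:
  "biform k n (\<lambda>a b. x * c a b + y * c' a b) z = x * biform k n c z + y * biform k n c' z"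
  unfolding biform_def by (simp add: sum_distrib_left sum.distrib algebra_simps del: sum.lessThan_Suc)

lemma biform_mult_monomial:
  assumes "q \<in> monomials k d"
  shows "(\<lambda>z. biform k n c z * q z) \<in> cspan (vec_monomials k n (Suc d))"
proof -
  have "(\<lambda>z. \<Sum>ab\<in>{..<Suc k} \<times> {..<n}. c (fst ab) (snd ab) * (z (Inl (fst ab)) * q z * z (Inr (snd ab))))
      \<in> cspan (vec_monomials k n (Suc d))"
    by (intro cspan_sum[where f = "\<lambda>ab z. z (Inl (fst ab)) * q z * z (Inr (snd ab))"]
        cspan_base vec_monomialsI monomials_SucI assms) auto
  moreover have "(\<Sum>ab\<in>{..<Suc k} \<times> {..<n}. c (fst ab) (snd ab) * (z (Inl (fst ab)) * q z * z (Inr (snd ab))))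
      = biform k n c z * q z" for z
    unfolding biform_def sum_distrib_right sum.cartesian_product by (simp add: case_prod_unfold mult_ac)
  ultimately show ?thesis by simp
qed

lemma cspan_weighted_sum_zero:
  assumes "f \<in> cspan S" "\<And>g. g \<in> S \<Longrightarrow> (\<Sum>p\<in>P. a p * g p) = 0"
  shows "(\<Sum>p\<in>P. a p * f p) = 0"
  using assms(1)
proof induction
  case (step g f c)
  have "(\<Sum>p\<in>P. a p * (c * g p + f p)) = c * (\<Sum>p\<in>P. a p * g p) + (\<Sum>p\<in>P. a p * f p)"
    by (simp add: sum_distrib_left sum.distrib algebra_simps)
  then show ?case
    using step assms(2) by simp
qed simp

text \<open>A multiple of \<open>R1 i\<close> differs from the same multiple of the system at
  \<open>s\<close> by \<open>1 - s\<close> times the multiple of \<open>R1 i - R0 i\<close>.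
  Collecting these differences gives \<open>h\<close>. One \<open>h\<close> for all \<open>s\<close>
  is the point: it yields one matrix for the whole line.\<close>

lemma cspan_along_line:
  assumes "f \<in> cspan ({\<lambda>z. R1 i z * q z | i q. i < N \<and> q \<in> Q} \<union> G)"
    and "\<And>i q. i < N \<Longrightarrow> q \<in> Q \<Longrightarrow> (\<lambda>z. (R1 i z - R0 i z) * q z) \<in> cspan \<Omega>"
  shows "\<exists>h\<in>cspan \<Omega>. \<forall>s. (\<lambda>z. f z - (1 - s) * h z)
    \<in> cspan ({\<lambda>z. ((1 - s) * R0 i z + s * R1 i z) * q z | i q. i < N \<and> q \<in> Q} \<union> G)"
    (is "\<exists>h\<in>_. \<forall>s. _ \<in> cspan (?S s \<union> G)")
  using assms(1)
proof induction
  case zero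
  show ?case
    using cspan.zero by (intro bexI[of _ "\<lambda>_. 0"]) auto
next
  case (step g f c)
  then obtain h where h: "h \<in> cspan \<Omega>" "\<And>s. (\<lambda>z. f z - (1 - s) * h z) \<in> cspan (?S s \<union> G)"
    by blast
  obtain h' where h': "h' \<in> cspan \<Omega>" "\<And>s. (\<lambda>z. g z - (1 - s) * h' z) \<in> cspan (?S s \<union> G)"
  proof (cases "g \<in> G")
    case True
    then show ?thesis
      by (intro that[of "\<lambda>_. 0"]) (auto intro: cspan.zero cspan_base)
  next
    case False
    then obtain i q where g: "i < N" "q \<in> Q" "g = (\<lambda>z. R1 i z * q z)"
      using step.hyps(1) by blast
    have "(\<lambda>z. ((1 - s) * R0 i z + s * R1 i z) * q z) \<in> cspan (?S s \<union> G)" for s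
      using g by (intro cspan_base) blast
    then show ?thesis
      using that[OF assms(2)[OF g(1,2)]] by (simp add: g(3) algebra_simps)
  qed
  have 1: "(\<lambda>z. c * h' z + h z) \<in> cspan \<Omega>"
    using cspan_add[OF cspan_scale[OF h'(1)] h(1)] .
  have 2: "(\<lambda>z. (c * g z + f z) - (1 - s) * (c * h' z + h z)) \<in> cspan (?S s \<union> G)" for s
    using cspan_add[OF cspan_scale[OF h'(2)[of s], of c] h(2)[of s]] by (simp add: algebra_simps)
  show ?case
    by (rule bexI[OF _ 1], rule allI, rule 2)
qed

text \<open>
  A weighted sum of point evaluations at common zeros of the system on the line, which also kills \<open>G\<close>, is an
  eigenvector of one fixed matrix with eigenvalue \<open>1 / (1 - s)\<close>.
\<close>

lemma finite_exceptional_parameters: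
  fixes R0 R1 :: "nat \<Rightarrow> 'z \<Rightarrow> complex"
  assumes "finite \<Omega>"
    and "\<And>\<omega>. \<omega> \<in> \<Omega> \<Longrightarrow> \<omega> \<in> cspan ({\<lambda>z. R1 i z * q z | i q. i < N \<and> q \<in> Q} \<union> G)"
    and "\<And>i q. i < N \<Longrightarrow> q \<in> Q \<Longrightarrow> (\<lambda>z. (R1 i z - R0 i z) * q z) \<in> cspan \<Omega>"
  shows "finite {s. \<exists>P a. (\<forall>p\<in>P. \<forall>i<N. (1 - s) * R0 i p + s * R1 i p = 0) \<and>
    (\<forall>g\<in>G. (\<Sum>p\<in>P. a p * g p) = 0) \<and> (\<exists>\<omega>\<in>\<Omega>. (\<Sum>p\<in>P. a p * \<omega> p) \<noteq> 0)}" (is "finite ?X")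
proof -
  let ?S = "\<lambda>s. {\<lambda>z. ((1 - s) * R0 i z + s * R1 i z) * q z | i q. i < N \<and> q \<in> Q}"
  have "\<forall>\<omega>\<in>\<Omega>. \<exists>h. h \<in> cspan \<Omega> \<and> (\<forall>s. (\<lambda>z. \<omega> z - (1 - s) * h z) \<in> cspan (?S s \<union> G))"
    using cspan_along_line[OF assms(2) assms(3)] unfolding Bex_def by (intro ballI)
  from bchoice[OF this] obtain h where h: "\<And>\<omega>. \<omega> \<in> \<Omega> \<Longrightarrow> h \<omega> \<in> cspan \<Omega>"
    "\<And>\<omega> s. \<omega> \<in> \<Omega> \<Longrightarrow> (\<lambda>z. \<omega> z - (1 - s) * h \<omega> z) \<in> cspan (?S s \<union> G)"
    by blast
  have "\<forall>\<omega>\<in>\<Omega>. \<exists>Y. h \<omega> = (\<lambda>z. \<Sum>\<omega>'\<in>\<Omega>. Y \<omega>' * \<omega>' z)"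
    using cspan_finite[OF h(1) assms(1)] by (intro ballI)
  from bchoice[OF this] obtain Y where Y: "\<And>\<omega>. \<omega> \<in> \<Omega> \<Longrightarrow> h \<omega> = (\<lambda>z. \<Sum>\<omega>'\<in>\<Omega>. Y \<omega> \<omega>' * \<omega>' z)"
    by blast
  let ?E = "{\<sigma>. \<exists>v. (\<exists>\<omega>\<in>\<Omega>. v \<omega> \<noteq> 0) \<and> (\<forall>\<omega>\<in>\<Omega>. v \<omega> = \<sigma> * (\<Sum>\<omega>'\<in>\<Omega>. Y \<omega> \<omega>' * v \<omega>'))}"
  have "?X \<subseteq> (\<lambda>\<sigma>. 1 - \<sigma>) ` ?E"
  proof
    fix s assume "s \<in> ?X"
    then obtain P a where zero: "\<And>p i. p \<in> P \<Longrightarrow> i < N \<Longrightarrow> (1 - s) * R0 i p + s * R1 i p = 0"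
      and G: "\<And>g. g \<in> G \<Longrightarrow> (\<Sum>p\<in>P. a p * g p) = 0" and nz: "\<exists>\<omega>\<in>\<Omega>. (\<Sum>p\<in>P. a p * \<omega> p) \<noteq> 0"
      by blast
    have "(\<Sum>p\<in>P. a p * \<omega> p) = (1 - s) * (\<Sum>\<omega>'\<in>\<Omega>. Y \<omega> \<omega>' * (\<Sum>p\<in>P. a p * \<omega>' p))"
      if "\<omega> \<in> \<Omega>" for \<omega>
    proof -
      have "(\<Sum>p\<in>P. a p * (\<omega> p - (1 - s) * h \<omega> p)) = 0"
        using h(2)[OF that, of s]
      proof (rule cspan_weighted_sum_zero)
        fix g assume "g \<in> ?S s \<union> G"
        then show "(\<Sum>p\<in>P. a p * g p) = 0"
        proof
          assume "g \<in> ?S s"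
          then show ?thesis
            using zero by (auto intro!: sum.neutral)
        qed (rule G)
      qed
      moreover have "(\<Sum>p\<in>P. a p * (\<omega> p - (1 - s) * h \<omega> p))
          = (\<Sum>p\<in>P. a p * \<omega> p) - (1 - s) * (\<Sum>p\<in>P. a p * h \<omega> p)"
        by (simp add: right_diff_distrib sum_subtractf sum_distrib_left mult.left_commute)
      ultimately have "(\<Sum>p\<in>P. a p * \<omega> p) = (1 - s) * (\<Sum>p\<in>P. a p * h \<omega> p)"
        by simp
      also have "(\<Sum>p\<in>P. a p * h \<omega> p) = (\<Sum>\<omega>'\<in>\<Omega>. Y \<omega> \<omega>' * (\<Sum>p\<in>P. a p * \<omega>' p))"
        unfolding Y[OF that] sum_distrib_left by (subst sum.swap) (simp add: mult_ac)
      finally show ?thesis .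
    qed
    then have "1 - s \<in> ?E"
      using nz by (intro CollectI exI[of _ "\<lambda>\<omega>. \<Sum>p\<in>P. a p * \<omega> p"]) blast
    then show "s \<in> (\<lambda>\<sigma>. 1 - \<sigma>) ` ?E"
      by (rule rev_image_eqI) simp
  qed
  then show ?thesis
    using finite_eigenvalues[OF assms(1)] finite_surj by blast
qed

lemma power_monomial: "(\<lambda>z. z (Inl k) ^ d) \<in> monomials k d"
proof (induction d)
  case (Suc d)
  then show ?case
    using monomials_SucI[of k k] by simp
qed simp

text \<open>Supplies homogenized separating polynomials: in the chart \<open>z (Inl k) = 1\<close>
  each factor excludes one value of one parameter, and the power of \<open>z (Inl k)\<close> pads
  the product to a prescribed degree.\<close>

lemma prod_affine_forms_cspan:
  assumes "finite I" "\<And>i. i \<in> I \<Longrightarrow> \<alpha> i \<le> k"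
  shows "(\<lambda>z. (\<Prod>i\<in>I. z (Inl (\<alpha> i)) - \<beta> i * z (Inl k)) * z (Inl k) ^ e) \<in> cspan (monomials k (card I + e))"
  using assms
proof (induction I)
  case empty
  then show ?case
    using power_monomial by (auto intro: cspan_base)
next
  case (insert i I)
  let ?f = "\<lambda>z. (\<Prod>i\<in>I. z (Inl (\<alpha> i)) - \<beta> i * z (Inl k)) * z (Inl k) ^ e"
  have "(\<lambda>z. z (Inl a) * ?f z) \<in> cspan (monomials k (Suc (card I + e)))" if "a \<le> k" for a
    using insert that by (intro cspan_mult_left[OF insert.IH] cspan_base monomials_SucI) auto
  then have "(\<lambda>z. z (Inl (\<alpha> i)) * ?f z + (- \<beta> i) * (z (Inl k) * ?f z))
      \<in> cspan (monomials k (Suc (card I + e)))"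
    using insert.prems by (intro cspan_add[OF _ cspan_scale]) auto
  then show ?case
    using insert.hyps by (simp add: algebra_simps)
qed

text \<open>More than \<open>N choose k\<close> zeros would admit nontrivial weights that annihilate
  \<open>G\<close>. Off the exceptional set these annihilate all forms of degree
  \<open>Suc d\<close>, in contradiction to a form that vanishes at all chosen zeros but one of
  nonzero weight.\<close>

lemma few_zeros_on_generic_system:
  fixes C0 :: "nat \<Rightarrow> nat \<Rightarrow> nat \<Rightarrow> complex"
  assumes "Suc N = n + k"
  defines "C \<equiv> (\<lambda>s i a b. (1 - s) * C0 i a b + s * (of_nat i ^ a * of_nat i ^ b))"
  shows "\<exists>X. finite X \<and> (\<forall>s P. s \<notin> X \<and> finite P \<and>
    (\<forall>z\<in>P. z (Inl k) = 1 \<and> (\<exists>b<n. z (Inr b) \<noteq> 0) \<and> (\<forall>i<N. biform k n (C s i) z = 0)) \<and>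
    (\<forall>z\<in>P. \<forall>w\<in>P. z \<noteq> w \<longrightarrow> (\<exists>a\<le>k. z (Inl a) \<noteq> w (Inl a))) \<longrightarrow> card P \<le> N choose k)"
proof -
  define D where "D = N choose k"
  \<comment> \<open>One degree for two demands: \<open>Suc d > N\<close> starts the reduction at
    \<open>j = 0\<close>, and \<open>Suc d\<close> exceeds \<open>D\<close>, the number of factors
    of the separating product.\<close>
  define d where "d = N + D"
  define R0 where "R0 = (\<lambda>i. biform k n (C0 i))"
  define R1 where "R1 = (\<lambda>i z. lform k i z * hform n i z)"
  let ?pt = "\<lambda>T z. (\<Prod>i\<in>{0..<N} - T. lform k i z) * z (Inl k) ^ (Suc d - card ({0..<N} - T)) * z (Inr (n - 1))"
  define G where "G = ?pt ` {T. T \<subseteq> {..<N} \<and> card T = k}"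
  define \<Omega> where "\<Omega> = vec_monomials k n (Suc d)"
  have line: "(1 - s) * R0 i z + s * R1 i z = biform k n (C s i) z" for s i z
    unfolding R0_def R1_def C_def biform_linear biform_product ..
  have sets: "finite {T. T \<subseteq> {..<N} \<and> card T = k}" "card {T. T \<subseteq> {..<N} \<and> card T = k} = D"
    using n_subsets[of "{..<N}" k] by (simp_all add: D_def)
  then have G: "finite G" "card G \<le> D"
    using card_image_le[OF sets(1), of ?pt] by (simp_all add: G_def)
  define X where "X = {s. \<exists>P a. (\<forall>p\<in>P. \<forall>i<N. (1 - s) * R0 i p + s * R1 i p = 0) \<and>
    (\<forall>g\<in>G. (\<Sum>p\<in>P. a p * g p) = 0) \<and> (\<exists>\<omega>\<in>\<Omega>. (\<Sum>p\<in>P. a p * \<omega> p) \<noteq> 0)}"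
  have "finite X"
    unfolding X_def
  proof (rule finite_exceptional_parameters[where Q = "monomials k d"])
    show "finite \<Omega>"
      unfolding \<Omega>_def by (rule finite_vec_monomials)
  next
    fix \<omega> assume "\<omega> \<in> \<Omega>"
    then have "\<omega> \<in> cspan (mixed_gens k n N 0 {} (Suc d))"
      unfolding \<Omega>_def by (intro vec_monomials_mixed_gens[OF assms(1)]) (auto simp: d_def)
    moreover have "mixed_gens k n N 0 {} (Suc d)
        \<subseteq> {\<lambda>z. R1 i z * q z | i q. i < N \<and> q \<in> monomials k d} \<union> G"
      unfolding mixed_gens_def R1_def G_def by auto
    ultimately show "\<omega> \<in> cspan ({\<lambda>z. R1 i z * q z | i q. i < N \<and> q \<in> monomials k d} \<union> G)"
      by (rule cspan_mono)
  next
    fix i q assume "q \<in> monomials k d"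
    then show "(\<lambda>z. (R1 i z - R0 i z) * q z) \<in> cspan \<Omega>"
      using biform_mult_monomial[of q k d n "\<lambda>a b. 1 * (of_nat i ^ a * of_nat i ^ b) + (-1) * C0 i a b"]
      unfolding biform_linear biform_product \<Omega>_def R0_def R1_def by simp
  qed
  have card: "card P \<le> D" if "s \<notin> X" "finite P"
    and zero: "\<And>z i. z \<in> P \<Longrightarrow> i < N \<Longrightarrow> biform k n (C s i) z = 0"
    and z1: "\<And>z. z \<in> P \<Longrightarrow> z (Inl k) = 1" and z2: "\<And>z. z \<in> P \<Longrightarrow> \<exists>b<n. z (Inr b) \<noteq> 0"
    and sep: "\<And>z w. z \<in> P \<Longrightarrow> w \<in> P \<Longrightarrow> z \<noteq> w \<Longrightarrow> \<exists>a\<le>k. z (Inl a) \<noteq> w (Inl a)" for s P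
  proof (rule ccontr)
    assume "\<not> card P \<le> D"
    then obtain P' where P': "P' \<subseteq> P" "card P' = Suc D" "finite P'"
      using obtain_subset_with_card_n[of "Suc D" P] by (metis not_less_eq_eq)
    obtain e where e: "bij_betw e {..<card G} G"
      using ex_bij_betw_nat_finite[OF G(1)] by (auto simp: atLeast0LessThan)
    have lin: "(\<Sum>p\<in>P'. (x * \<xi> p + y * \<zeta> p) * g p)
        = x * (\<Sum>p\<in>P'. \<xi> p * g p) + y * (\<Sum>p\<in>P'. \<zeta> p * g p)" 
      for x y :: complex and \<xi> \<zeta> g
      by (simp add: sum.distrib sum_distrib_left algebra_simps)
    \<comment> \<open>There are \<open>Suc D\<close> weights and at most \<open>D\<close>
      conditions.\<close>
    obtain a where a: "\<exists>p. a p \<noteq> 0" "\<And>p. p \<notin> P' \<Longrightarrow> a p = 0"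
      "\<And>i. i < card G \<Longrightarrow> (\<Sum>p\<in>P'. a p * e i p) = 0"
      using underdetermined_system[of "card G" "\<lambda>i a. \<Sum>p\<in>P'. a p * e i p" P', OF lin] P'(2,3) G(2)
      by auto
    have "(\<Sum>p\<in>P'. a p * g p) = 0" if "g \<in> G" for g
    proof -
      have "g \<in> e ` {..<card G}"
        using that bij_betw_imp_surj_on[OF e] by simp
      then obtain i where "i < card G" "g = e i"
        by (rule imageE) (simp only: lessThan_iff)
      then show ?thesis
        using a(3) by simp
    qed
    moreover have "\<forall>p\<in>P'. \<forall>i<N. (1 - s) * R0 i p + s * R1 i p = 0"
      using zero P'(1) by (auto simp: line)
    ultimately have \<Omega>0: "(\<Sum>p\<in>P'. a p * \<omega> p) = 0" if "\<omega> \<in> \<Omega>" for \<omega>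
      using \<open>s \<notin> X\<close> that unfolding X_def by blast
    obtain p0 where p0: "p0 \<in> P'" "a p0 \<noteq> 0"
      using a by blast
    obtain b where b: "b < n" "p0 (Inr b) \<noteq> 0"
      using z2 p0 P' by blast
    have "\<forall>p\<in>P' - {p0}. \<exists>c\<le>k. p0 (Inl c) \<noteq> p (Inl c)"
      using sep p0 P'(1) by blast
    from bchoice[OF this]
    obtain \<alpha> where \<alpha>: "\<And>p. p \<in> P' - {p0} \<Longrightarrow> \<alpha> p \<le> k \<and> p0 (Inl (\<alpha> p)) \<noteq> p (Inl (\<alpha> p))"
      by blast
    \<comment> \<open>In the chart the factor of \<open>p\<close> vanishes at \<open>p\<close> but
      not at \<open>p0\<close>, since the two differ in parameter \<open>\<alpha> p\<close>. The
      entry \<open>b\<close> is nonzero at \<open>p0\<close>.\<close>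
    define f where "f = (\<lambda>z. z (Inr b) *
      ((\<Prod>p\<in>P' - {p0}. z (Inl (\<alpha> p)) - p (Inl (\<alpha> p)) * z (Inl k)) * z (Inl k) ^ Suc N))"
    have "card (P' - {p0}) + Suc N = Suc d"
      using P' p0 by (simp add: d_def)
    then have *: "(\<lambda>z. (\<Prod>p\<in>P' - {p0}. z (Inl (\<alpha> p)) - p (Inl (\<alpha> p)) * z (Inl k)) * z (Inl k) ^ Suc N)
        \<in> cspan (monomials k (Suc d))"
      using prod_affine_forms_cspan[of "P' - {p0}" \<alpha> k "\<lambda>p. p (Inl (\<alpha> p))" "Suc N"] P'(3) \<alpha> by simp
    have "f \<in> cspan \<Omega>"
      unfolding f_def
    proof (rule cspan_mult_left[OF *])
      fix g assume "g \<in> monomials k (Suc d)"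
      then have "(\<lambda>z. g z * z (Inr b)) \<in> \<Omega>"
        unfolding \<Omega>_def using b(1) by (rule vec_monomialsI)
      then show "(\<lambda>z. z (Inr b) * g z) \<in> cspan \<Omega>"
        by (subst mult.commute) (rule cspan_base)
    qed
    then have "(\<Sum>p\<in>P'. a p * f p) = 0"
      using \<Omega>0 by (rule cspan_weighted_sum_zero)
    moreover have "f p = 0" if "p \<in> P' - {p0}" for p
    proof -
      have "p (Inl k) = 1"
        using z1 that P'(1) by blast
      then have "(\<Prod>q\<in>P' - {p0}. p (Inl (\<alpha> q)) - q (Inl (\<alpha> q)) * p (Inl k)) = 0"
        using that P'(3) by (intro prod_zero) auto
      then show ?thesis by (simp add: f_def)
    qed
    ultimately have "a p0 * f p0 = 0"
      using p0 P'(3) by (simp add: sum.remove)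
    moreover have "f p0 \<noteq> 0"
    proof -
      have "p0 (Inl k) = 1"
        using z1 p0 P'(1) by blast
      then show ?thesis
        using b(2) \<alpha> P'(3) by (simp add: f_def)
    qed
    ultimately show False
      using p0 by simp
  qed
  show ?thesis
    unfolding D_def[symmetric]
  proof (intro exI[of _ X] conjI allI impI)
    fix s P
    assume asm: "s \<notin> X \<and> finite P \<and>
      (\<forall>z\<in>P. z (Inl k) = 1 \<and> (\<exists>b<n. z (Inr b) \<noteq> 0) \<and> (\<forall>i<N. biform k n (C s i) z = 0)) \<and>
      (\<forall>z\<in>P. \<forall>w\<in>P. z \<noteq> w \<longrightarrow> (\<exists>a\<le>k. z (Inl a) \<noteq> w (Inl a)))"
    show "card P \<le> D"
      by (rule card[of s P]) (simp_all add: asm)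
  qed (rule \<open>finite X\<close>)
qed

section \<open>Isolated zeros of square systems persist\<close>

text \<open>Up to the term with \<open>T\<close>, the right side is \<open>S\<close> times the
  squared modulus of a holomorphic \<open>F\<close> with \<open>F 0 = 1\<close>. Near
  \<open>0\<close> the quadratic gain on the left beats the fourth-order term, so \<open>F\<close>
  has no zero on a small disc and modulus above \<open>1\<close> on its circle, against the maximum
  modulus principle for \<open>1 / F\<close>.\<close>

lemma quadratic_exp_modulus_not_min:
  fixes c \<beta> \<kappa> :: complex and S X T r0 :: real
  assumes "S > 0" "X > 0" "T \<ge> 0" "r0 > 0"
    and min: "\<And>\<tau>. cmod \<tau> \<le> r0 \<Longrightarrow> S * exp (X * (cmod \<tau>)\<^sup>2)
      \<le> (S * (cmod (1 + c * \<tau> + \<beta> * \<tau>\<^sup>2))\<^sup>2 + (cmod \<tau>) ^ 4 * T) * exp (- 2 * Re (\<kappa> * \<tau>))"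
  shows False
proof -
  define F where "F = (\<lambda>\<tau>. (1 + c * \<tau> + \<beta> * \<tau>\<^sup>2) * exp (- (\<kappa> * \<tau>)))"
  define M where "M = T * exp (2 * cmod \<kappa>)"
  \<comment> \<open>\<open>r \<le> 1\<close> bounds the exponential factor by
    \<open>exp (2 * cmod \<kappa>)\<close>, and the square root makes
    \<open>r\<^sup>2 * M < S * X\<close>, that is \<open>\<gamma> > 0\<close>.\<close>
  define r where "r = min (min r0 1) (sqrt (S * X / (M + 1)))"
  define \<gamma> where "\<gamma> = (S * X - r\<^sup>2 * M) / S"
  have "M \<ge> 0"
    using assms by (simp add: M_def)
  have r: "r > 0" "r \<le> r0" "r \<le> 1" "r \<le> sqrt (S * X / (M + 1))"
    using assms \<open>M \<ge> 0\<close> by (auto simp: r_def)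
  have "r\<^sup>2 \<le> S * X / (M + 1)"
    using r(1,4) assms \<open>M \<ge> 0\<close> real_le_rsqrt[of r] power_mono[OF r(4), of 2] by simp
  then have "r\<^sup>2 * (M + 1) \<le> S * X"
    using \<open>M \<ge> 0\<close> by (simp add: pos_le_divide_eq)
  moreover have "r\<^sup>2 * (M + 1) > r\<^sup>2 * M"
    using r(1) by simp
  ultimately have "\<gamma> > 0"
    using assms(1) by (simp add: \<gamma>_def)
  have F: "1 + (cmod \<tau>)\<^sup>2 * \<gamma> \<le> (cmod (F \<tau>))\<^sup>2" if "cmod \<tau> \<le> r" for \<tau>
  proof -
    have "cmod \<tau> \<le> 1"
      using that r by simp
    have "\<bar>Re (\<kappa> * \<tau>)\<bar> \<le> cmod \<kappa> * cmod \<tau>"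
      by (metis abs_Re_le_cmod norm_mult)
    also have "\<dots> \<le> cmod \<kappa>"
      using \<open>cmod \<tau> \<le> 1\<close> by (simp add: mult_left_le)
    finally have "exp (- 2 * Re (\<kappa> * \<tau>)) \<le> exp (2 * cmod \<kappa>)"
      by simp
    then have "(cmod \<tau>) ^ 4 * T * exp (- 2 * Re (\<kappa> * \<tau>)) \<le> (cmod \<tau>) ^ 4 * M"
      unfolding M_def using assms(3) by (simp add: mult_left_mono mult.assoc)
    moreover have "(cmod (F \<tau>))\<^sup>2 = (cmod (1 + c * \<tau> + \<beta> * \<tau>\<^sup>2))\<^sup>2 * exp (- 2 * Re (\<kappa> * \<tau>))"
      by (simp add: F_def norm_mult power_mult_distrib flip: exp_double)
    moreover have "S * (1 + X * (cmod \<tau>)\<^sup>2) \<le> S * exp (X * (cmod \<tau>)\<^sup>2)"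
      using assms(1) exp_ge_add_one_self by (intro mult_left_mono) auto
    ultimately have "S * (1 + X * (cmod \<tau>)\<^sup>2) \<le> S * (cmod (F \<tau>))\<^sup>2 + (cmod \<tau>) ^ 4 * M"
      using min[of \<tau>] that r(2) by (simp add: algebra_simps)
    moreover have "(cmod \<tau>) ^ 4 * M \<le> (cmod \<tau>)\<^sup>2 * r\<^sup>2 * M"
    proof -
      have "(cmod \<tau>) ^ 4 = (cmod \<tau>)\<^sup>2 * (cmod \<tau>)\<^sup>2"
        by (simp flip: power_add)
      also have "\<dots> \<le> (cmod \<tau>)\<^sup>2 * r\<^sup>2"
        using that by (intro mult_left_mono power_mono) auto
      finally show ?thesis
        using \<open>M \<ge> 0\<close> by (rule mult_right_mono)
    qed
    moreover have "S * (1 + (cmod \<tau>)\<^sup>2 * \<gamma>) = S * (1 + X * (cmod \<tau>)\<^sup>2) - (cmod \<tau>)\<^sup>2 * r\<^sup>2 * M"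
    proof -
      have "S * \<gamma> = S * X - r\<^sup>2 * M"
        using assms(1) by (simp add: \<gamma>_def)
      then have "(cmod \<tau>)\<^sup>2 * (S * \<gamma>) = (cmod \<tau>)\<^sup>2 * (S * X - r\<^sup>2 * M)"
        by simp
      then show ?thesis
        by (simp add: algebra_simps)
    qed
    ultimately have "S * (1 + (cmod \<tau>)\<^sup>2 * \<gamma>) \<le> S * (cmod (F \<tau>))\<^sup>2"
      by simp
    then show ?thesis
      using assms(1) by simp
  qed
  have nz: "F \<tau> \<noteq> 0" if "cmod \<tau> \<le> r" for \<tau>
  proof -
    have "0 < 1 + (cmod \<tau>)\<^sup>2 * \<gamma>"
      using \<open>\<gamma> > 0\<close> by (simp add: add_pos_nonneg)
    then show ?thesis
      using F[OF that] by auto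
  qed
  have holo: "(\<lambda>\<tau>. inverse (F \<tau>)) holomorphic_on cball 0 r"
    using nz unfolding F_def by (intro holomorphic_intros) auto
  define B where "B = inverse (sqrt (1 + r\<^sup>2 * \<gamma>))"
  have "norm (inverse (F 0)) \<le> B"
  proof (rule maximum_modulus_frontier[of "\<lambda>\<tau>. inverse (F \<tau>)" "ball 0 r"])
    show "(\<lambda>\<tau>. inverse (F \<tau>)) holomorphic_on interior (ball 0 r)"
      using holo by (rule holomorphic_on_subset) auto
    show "continuous_on (closure (ball 0 r)) (\<lambda>\<tau>. inverse (F \<tau>))"
      using holo r(1) by (simp add: holomorphic_on_imp_continuous_on)
    fix \<tau> :: complex assume "\<tau> \<in> frontier (ball 0 r)"
    then have \<tau>: "cmod \<tau> = r"
      using r(1) by simp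
    then have "sqrt (1 + r\<^sup>2 * \<gamma>) \<le> cmod (F \<tau>)"
      using F[of \<tau>] by (intro real_le_lsqrt) auto
    moreover have "0 < sqrt (1 + r\<^sup>2 * \<gamma>)"
      using \<open>\<gamma> > 0\<close> by (simp add: add_pos_nonneg)
    ultimately show "norm (inverse (F \<tau>)) \<le> B"
      unfolding B_def norm_inverse by (intro le_imp_inverse_le)
  qed (use r(1) in auto)
  moreover have "B < 1"
    using \<open>\<gamma> > 0\<close> r(1) by (simp add: B_def inverse_less_1_iff)
  ultimately show False
    by (simp add: F_def)
qed

text \<open>Pythagoras for the hermitian product.\<close>

lemma sum_cmod_square_orthogonal:
  fixes a b :: "'i \<Rightarrow> complex"
  assumes "(\<Sum>i\<in>I. b i * cnj (a i)) = 0"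
  shows "(\<Sum>i\<in>I. (cmod (f * a i + g * b i))\<^sup>2)
    = (cmod f)\<^sup>2 * (\<Sum>i\<in>I. (cmod (a i))\<^sup>2) + (cmod g)\<^sup>2 * (\<Sum>i\<in>I. (cmod (b i))\<^sup>2)"
proof -
  have "(cmod (f * a i + g * b i))\<^sup>2
      = (cmod f)\<^sup>2 * (cmod (a i))\<^sup>2 + (cmod g)\<^sup>2 * (cmod (b i))\<^sup>2 + 2 * Re (g * cnj f * (b i * cnj (a i)))" for i
    unfolding cmod_power2 by (simp add: power2_eq_square algebra_simps)
  then have "(\<Sum>i\<in>I. (cmod (f * a i + g * b i))\<^sup>2)
      = (cmod f)\<^sup>2 * (\<Sum>i\<in>I. (cmod (a i))\<^sup>2) + (cmod g)\<^sup>2 * (\<Sum>i\<in>I. (cmod (b i))\<^sup>2)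
        + 2 * Re (g * cnj f * (\<Sum>i\<in>I. b i * cnj (a i)))"
    by (simp only: sum.distrib sum_distrib_left Re_sum)
  then show ?thesis
    by (simp add: assms)
qed

section \<open>Bilinear systems on polydiscs\<close>

definition biform_deriv :: "nat \<Rightarrow> nat \<Rightarrow> (nat \<Rightarrow> nat \<Rightarrow> complex) \<Rightarrow> (nat + nat \<Rightarrow> complex) \<Rightarrow> (nat + nat \<Rightarrow> complex) \<Rightarrow> complex"
  where "biform_deriv k n c z \<xi> = (\<Sum>a<Suc k. \<Sum>b<n. c a b * (z (Inl a) * \<xi> (Inr b) + \<xi> (Inl a) * z (Inr b)))"

lemma biform_expand:
  "biform k n c (\<lambda>j. z j + \<tau> * \<xi> j) = biform k n c z + \<tau> * biform_deriv k n c z \<xi> + \<tau>\<^sup>2 * biform k n c \<xi>"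
  unfolding biform_def biform_deriv_def sum_distrib_left sum.distrib[symmetric]
  by (intro sum.cong) (simp_all add: algebra_simps power2_eq_square)

lemma biform_deriv_linear:
  "biform_deriv k n c z (\<lambda>j. x * \<xi> j + y * \<zeta> j) = x * biform_deriv k n c z \<xi> + y * biform_deriv k n c z \<zeta>"
  unfolding biform_deriv_def sum_distrib_left sum.distrib[symmetric]
  by (intro sum.cong) (simp_all add: algebra_simps)

lemma continuous_on_biform [continuous_intros]: "continuous_on S (biform k n c)"
  unfolding biform_def
  by (intro continuous_intros continuous_on_subset[OF continuous_on_product_coordinates]) auto

text \<open>Freezing the coordinates outside \<open>J\<close> preserves the normalisation of a chart
  and makes the set a product of discs and points, hence compact in the product topology on
  functions.\<close>

definition polydisc :: "'j set \<Rightarrow> ('j \<Rightarrow> complex) \<Rightarrow> real \<Rightarrow> ('j \<Rightarrow> complex) set"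
  where "polydisc J z0 \<eta> = {z. (\<forall>j\<in>J. cmod (z j - z0 j) \<le> \<eta>) \<and> (\<forall>j. j \<notin> J \<longrightarrow> z j = z0 j)}"

lemma compact_polydisc: "compact (polydisc J z0 \<eta>)"
proof -
  have "polydisc J z0 \<eta> = PiE UNIV (\<lambda>j. if j \<in> J then cball (z0 j) \<eta> else {z0 j})"
    by (auto simp: polydisc_def PiE_UNIV_domain Pi_iff dist_norm norm_minus_commute split: if_splits)
  moreover have "compactin (product_topology (\<lambda>_. euclidean) UNIV)
      (PiE UNIV (\<lambda>j. if j \<in> J then cball (z0 j) \<eta> else {z0 j}))"
    by (subst compactin_PiE) auto
  ultimately show ?thesis
    by (simp add: euclidean_product_topology)
qed

lemma center_in_polydisc: "\<eta> \<ge> 0 \<Longrightarrow> z0 \<in> polydisc J z0 \<eta>"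
  by (simp add: polydisc_def)

text \<open>
  If there is no zero, \<open>W z * exp (- \<epsilon> * |z - z0|\<^sup>2)\<close> has an interior minimum \<open>z1\<close> for small \<open>\<epsilon> > 0\<close>. Choosing a
  direction \<open>\<xi> \<noteq> 0\<close> along which the derivative of the system at \<open>z1\<close> is a multiple of its value (such a
  direction exists since the system is square), the restriction to the complex line through \<open>z1\<close> contradicts the
  maximum modulus principle.
\<close>

lemma square_system_has_zero:
  fixes C :: "nat \<Rightarrow> nat \<Rightarrow> nat \<Rightarrow> complex" and k n N :: nat
  defines "W \<equiv> (\<lambda>z. \<Sum>i<N. (cmod (biform k n (C i) z))\<^sup>2)"
  assumes "finite J" "card J = N" "\<eta> > 0" "W z0 < \<rho>"
    and bdry: "\<And>z j. z \<in> polydisc J z0 \<eta> \<Longrightarrow> j \<in> J \<Longrightarrow> cmod (z j - z0 j) = \<eta> \<Longrightarrow> \<rho> \<le> W z"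
  shows "\<exists>z\<in>polydisc J z0 \<eta>. \<forall>i<N. biform k n (C i) z = 0"
proof (rule ccontr)
  let ?K = "polydisc J z0 \<eta>"
  assume "\<not> (\<exists>z\<in>?K. \<forall>i<N. biform k n (C i) z = 0)"
  then have no_zero: "\<forall>z\<in>?K. \<exists>i<N. biform k n (C i) z \<noteq> 0"
    by simp
  have W_pos: "W z > 0" if z: "z \<in> ?K" for z
  proof -
    obtain i where "i < N" "biform k n (C i) z \<noteq> 0"
      using bspec[OF no_zero z] by auto
    then show ?thesis
      unfolding W_def by (intro sum_pos2[of _ i]) auto
  qed
  have z0: "z0 \<in> ?K"
    using \<open>\<eta> > 0\<close> by (intro center_in_polydisc) simp
  define q where "q = (\<lambda>z. \<Sum>j\<in>J. (cmod (z j - z0 j))\<^sup>2)"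
  have "W z0 > 0"
    using W_pos[OF z0] .
  then have "ln (\<rho> / W z0) > 0"
    using \<open>W z0 < \<rho>\<close> by (intro ln_gt_zero) simp
  define M where "M = N * \<eta>\<^sup>2"
  have "M \<ge> 0"
    by (simp add: M_def)
  \<comment> \<open>\<open>M\<close> bounds \<open>q\<close> on the polydisc, so the weight lowers
    boundary values at most by the factor \<open>exp (- (\<epsilon> * M))\<close>. This
    \<open>\<epsilon>\<close> keeps them above \<open>W z0\<close>, the value of \<open>u\<close> at
    the center.\<close>
  define \<epsilon> where "\<epsilon> = ln (\<rho> / W z0) / (M + 1)"
  have "\<epsilon> > 0"
    using \<open>ln (\<rho> / W z0) > 0\<close> \<open>M \<ge> 0\<close> by (simp add: \<epsilon>_def)
  have \<epsilon>: "W z0 < \<rho> * exp (- (\<epsilon> * M))"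
  proof -
    have "\<epsilon> * M < \<epsilon> * (M + 1)"
      using \<open>\<epsilon> > 0\<close> by simp
    also have "\<dots> = ln (\<rho> / W z0)"
      using \<open>M \<ge> 0\<close> by (simp add: \<epsilon>_def)
    finally have "exp (\<epsilon> * M) < \<rho> / W z0"
      using \<open>W z0 > 0\<close> \<open>W z0 < \<rho>\<close> by (subst (asm) exp_less_cancel_iff[symmetric]) simp
    then show ?thesis
      using \<open>W z0 > 0\<close> by (simp add: exp_minus field_simps)
  qed
  \<comment> \<open>Without the weight, \<open>W\<close> could be constant along the line and the
    maximum principle would give nothing. On a complex line \<open>q\<close> contributes the strict
    gain \<open>X * (cmod \<tau>)\<^sup>2\<close> and the real part of a linear function, which
    becomes the modulus of an exponential.\<close>
  define u where "u = (\<lambda>z. W z * exp (- (\<epsilon> * q z)))"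
  have "continuous_on ?K u"
    unfolding u_def W_def q_def
    by (intro continuous_intros continuous_on_subset[OF continuous_on_product_coordinates]) auto
  moreover have "?K \<noteq> {}"
    using z0 by auto
  ultimately have "\<exists>z1\<in>?K. \<forall>z\<in>?K. u z1 \<le> u z"
    by (intro continuous_attains_inf compact_polydisc)
  then obtain z1 where z1: "z1 \<in> ?K" and min: "\<And>z. z \<in> ?K \<Longrightarrow> u z1 \<le> u z"
    by (auto simp only: Bex_def Ball_def)
  have "u z1 \<le> W z0"
    using min[OF z0] by (simp add: u_def q_def)
  have interior: "cmod (z1 j - z0 j) < \<eta>" if "j \<in> J" for j
  proof (rule ccontr)
    assume "\<not> cmod (z1 j - z0 j) < \<eta>"
    then have "cmod (z1 j - z0 j) = \<eta>"
      using z1 that by (auto simp: polydisc_def not_less intro: antisym)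
    then have "\<rho> \<le> W z1"
      by (rule bdry[OF z1 that])
    moreover have "q z1 \<le> (\<Sum>j\<in>J. \<eta>\<^sup>2)"
      unfolding q_def using z1 by (intro sum_mono power_mono) (auto simp: polydisc_def)
    then have "exp (- (\<epsilon> * M)) \<le> exp (- (\<epsilon> * q z1))"
      using \<open>\<epsilon> > 0\<close> \<open>card J = N\<close> by (simp add: M_def)
    ultimately have "\<rho> * exp (- (\<epsilon> * M)) \<le> u z1"
      unfolding u_def using W_pos[OF z1] by (intro mult_mono) auto
    then show False
      using \<epsilon> \<open>u z1 \<le> W z0\<close> by simp
  qed
  define a where "a = (\<lambda>i. biform k n (C i) z1)"
  \<comment> \<open>The unknowns are the direction (\<open>Some j\<close>) and the factor of
    \<open>a\<close> (\<open>None\<close>), one more than there are equations. A zero direction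
    would force the factor to vanish too, because some \<open>a i\<close> is nonzero.\<close>
  define L where "L = (\<lambda>i (\<zeta> :: (nat + nat) option \<Rightarrow> complex).
    biform_deriv k n (C i) z1 (\<lambda>j. \<zeta> (Some j)) - \<zeta> None * a i)"
  have "L i (\<lambda>j. x * \<xi> j + y * \<zeta> j) = x * L i \<xi> + y * L i \<zeta>" for i x y \<xi> \<zeta>
    by (simp add: L_def biform_deriv_linear algebra_simps)
  moreover have "N < card (insert None (Some ` J))"
    using \<open>finite J\<close> \<open>card J = N\<close> by (simp add: card_image)
  ultimately obtain \<zeta> where \<zeta>: "\<exists>j. \<zeta> j \<noteq> 0" "\<And>j. j \<notin> insert None (Some ` J) \<Longrightarrow> \<zeta> j = 0"
    and L0: "\<And>i. i < N \<Longrightarrow> L i \<zeta> = 0"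
    using underdetermined_system[of N L "insert None (Some ` J)"] \<open>finite J\<close> by blast
  define \<xi> where "\<xi> = (\<lambda>j. \<zeta> (Some j))"
  define c where "c = \<zeta> None"
  have deriv: "biform_deriv k n (C i) z1 \<xi> = c * a i" if "i < N" for i
    using L0[OF that] by (simp add: L_def \<xi>_def c_def)
  have \<xi>J: "\<xi> j = 0" if "j \<notin> J" for j
    using \<zeta>(2) that by (auto simp: \<xi>_def)
  have "\<exists>j\<in>J. \<xi> j \<noteq> 0"
  proof (rule ccontr)
    assume "\<not> ?thesis"
    then have \<xi>0: "\<xi> = (\<lambda>j. 0)"
      using \<xi>J by fastforce
    obtain i where "i < N" "a i \<noteq> 0"
      using bspec[OF no_zero z1] by (auto simp: a_def)
    then have "c = 0"
      using deriv[of i] by (simp add: \<xi>0 biform_deriv_def)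
    then have "\<zeta> j = 0" for j
      using \<xi>0 by (cases j) (auto simp: c_def \<xi>_def fun_eq_iff)
    then show False
      using \<zeta>(1) by blast
  qed
  define S where "S = W z1"
  have S: "S > 0" "S = (\<Sum>i<N. (cmod (a i))\<^sup>2)"
    using W_pos[OF z1] by (simp_all add: S_def W_def a_def)
  define X where "X = (\<Sum>j\<in>J. (cmod (\<xi> j))\<^sup>2)"
  have "X > 0"
    using \<open>\<exists>j\<in>J. \<xi> j \<noteq> 0\<close> \<open>finite J\<close> unfolding X_def by (auto intro: sum_pos2)
  define b where "b = (\<lambda>i. biform k n (C i) \<xi>)"
  \<comment> \<open>\<open>\<beta> * a i\<close> is the orthogonal projection of the second-order
    term \<open>b\<close> onto the value \<open>a\<close>. It joins the holomorphic factor; the rest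
    \<open>b'\<close> enters only with weight \<open>(cmod \<tau>) ^ 4\<close>.\<close>
  define \<beta> where "\<beta> = (\<Sum>i<N. b i * cnj (a i)) / S"
  define b' where "b' = (\<lambda>i. b i - \<beta> * a i)"
  define T where "T = (\<Sum>i<N. (cmod (b' i))\<^sup>2)"
  have orth: "(\<Sum>i<N. b' i * cnj (a i)) = 0"
  proof -
    have "(\<Sum>i<N. b' i * cnj (a i)) = (\<Sum>i<N. b i * cnj (a i)) - \<beta> * (\<Sum>i<N. a i * cnj (a i))"
      by (simp add: b'_def sum_subtractf sum_distrib_left algebra_simps)
    also have "(\<Sum>i<N. a i * cnj (a i)) = complex_of_real S"
      by (simp add: S(2) complex_norm_square[symmetric] del: of_real_power)
    finally show ?thesis
      using S(1) by (simp add: \<beta>_def)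
  qed
  define \<kappa> where "\<kappa> = (\<Sum>j\<in>J. \<xi> j * cnj (z1 j - z0 j))"
  let ?z = "\<lambda>\<tau> j. z1 j + \<tau> * \<xi> j"
  have W_line: "W (?z \<tau>) = S * (cmod (1 + c * \<tau> + \<beta> * \<tau>\<^sup>2))\<^sup>2 + (cmod \<tau>) ^ 4 * T" for \<tau>
  proof -
    have "biform k n (C i) (?z \<tau>) = (1 + c * \<tau> + \<beta> * \<tau>\<^sup>2) * a i + \<tau>\<^sup>2 * b' i" if "i < N" for i
      unfolding biform_expand deriv[OF that] by (simp add: a_def b_def b'_def algebra_simps)
    then have "W (?z \<tau>) = (\<Sum>i<N. (cmod ((1 + c * \<tau> + \<beta> * \<tau>\<^sup>2) * a i + \<tau>\<^sup>2 * b' i))\<^sup>2)"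
      unfolding W_def by simp
    then show ?thesis
      unfolding sum_cmod_square_orthogonal[OF orth] S(2)[symmetric] T_def[symmetric]
      by (simp add: norm_power mult.commute)
  qed
  have q_line: "q (?z \<tau>) = q z1 + 2 * Re (\<kappa> * \<tau>) + X * (cmod \<tau>)\<^sup>2" for \<tau>
  proof -
    have "(cmod (?z \<tau> j - z0 j))\<^sup>2
        = (cmod (z1 j - z0 j))\<^sup>2 + 2 * Re (\<xi> j * cnj (z1 j - z0 j) * \<tau>) + (cmod (\<xi> j))\<^sup>2 * (cmod \<tau>)\<^sup>2" for j
      unfolding cmod_power2 by (simp add: power2_eq_square algebra_simps)
    then show ?thesis
      unfolding q_def \<kappa>_def X_def by (simp only: sum.distrib sum_distrib_left sum_distrib_right Re_sum)
  qed
  have "\<exists>r0>0. \<forall>\<tau>. cmod \<tau> \<le> r0 \<longrightarrow> ?z \<tau> \<in> ?K"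
  proof -
    have "\<forall>\<^sub>F \<tau> in nhds 0. cmod (?z \<tau> j - z0 j) < \<eta>" if "j \<in> J" for j
    proof -
      have "((\<lambda>\<tau>. cmod (?z \<tau> j - z0 j)) \<longlongrightarrow> cmod (?z 0 j - z0 j)) (nhds 0)"
        by (intro tendsto_intros filterlim_ident)
      then show ?thesis
        using interior[OF that] by (auto dest: order_tendstoD(2))
    qed
    then have "\<forall>\<^sub>F \<tau> in nhds 0. \<forall>j\<in>J. cmod (?z \<tau> j - z0 j) < \<eta>"
      using \<open>finite J\<close> by (simp add: eventually_ball_finite)
    then obtain d where d: "d > 0" "\<And>\<tau>. cmod \<tau> < d \<Longrightarrow> \<forall>j\<in>J. cmod (?z \<tau> j - z0 j) < \<eta>"
      by (auto simp: eventually_nhds_metric dist_norm)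
    have "?z \<tau> \<in> ?K" if "cmod \<tau> \<le> d / 2" for \<tau>
      using d(2)[of \<tau>] d(1) that z1 \<xi>J by (auto simp: polydisc_def less_imp_le)
    then show ?thesis
      using d(1) by (intro exI[of _ "d / 2"]) simp
  qed
  then obtain r0 where r0: "r0 > 0" "\<And>\<tau>. cmod \<tau> \<le> r0 \<Longrightarrow> ?z \<tau> \<in> ?K"
    by blast
  show False
  proof (rule quadratic_exp_modulus_not_min[of S "\<epsilon> * X" T r0 c \<beta> "of_real \<epsilon> * \<kappa>"])
    show "S > 0" "\<epsilon> * X > 0" "T \<ge> 0" "r0 > 0"
      using S \<open>\<epsilon> > 0\<close> \<open>X > 0\<close> r0 by (auto simp: T_def intro: sum_nonneg)
    fix \<tau> assume "cmod \<tau> \<le> r0"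
    then have "S * exp (- (\<epsilon> * q z1)) \<le> W (?z \<tau>) * exp (- (\<epsilon> * q (?z \<tau>)))"
      using min[OF r0(2)] by (simp add: u_def S_def)
    also have "\<dots> = exp (- (\<epsilon> * q z1)) * (W (?z \<tau>) * exp (- 2 * Re (of_real \<epsilon> * \<kappa> * \<tau>))
        * exp (- (\<epsilon> * X * (cmod \<tau>)\<^sup>2)))"
      unfolding q_line by (simp add: algebra_simps flip: exp_add)
    finally have "S \<le> W (?z \<tau>) * exp (- 2 * Re (of_real \<epsilon> * \<kappa> * \<tau>)) / exp (\<epsilon> * X * (cmod \<tau>)\<^sup>2)"
      by (simp add: exp_minus field_simps)
    then show "S * exp (\<epsilon> * X * (cmod \<tau>)\<^sup>2)
        \<le> (S * (cmod (1 + c * \<tau> + \<beta> * \<tau>\<^sup>2))\<^sup>2 + (cmod \<tau>) ^ 4 * T) * exp (- 2 * Re (of_real \<epsilon> * \<kappa> * \<tau>))"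
      unfolding W_line by (simp add: pos_le_divide_eq)
  qed
qed

text \<open>On the boundary the squared norm of the original system is at least some
  \<open>\<delta> > 0\<close> by compactness, and at the center it is zero. A small perturbation
  preserves this gap, which is what \<open>square_system_has_zero\<close> asks for.\<close>

lemma isolated_zero_persists:
  fixes C0 C1 :: "nat \<Rightarrow> nat \<Rightarrow> nat \<Rightarrow> complex"
  assumes "finite J" "card J = N" "\<eta> > 0"
    and zero: "\<And>i. i < N \<Longrightarrow> biform k n (C0 i) z0 = 0"
    and only: "\<And>z. z \<in> polydisc J z0 \<eta> \<Longrightarrow> \<forall>i<N. biform k n (C0 i) z = 0 \<Longrightarrow> z = z0"
  shows "\<forall>\<^sub>F s in at 0. \<exists>z\<in>polydisc J z0 \<eta>. \<forall>i<N. biform k n (\<lambda>a b. (1 - s) * C0 i a b + s * C1 i a b) z = 0"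
proof -
  let ?K = "polydisc J z0 \<eta>"
  define W where "W = (\<lambda>z. \<Sum>i<N. (cmod (biform k n (C0 i) z))\<^sup>2)"
  define D where "D = (\<lambda>i a b. C1 i a b - C0 i a b)"
  define V where "V = (\<lambda>z. \<Sum>i<N. (cmod (biform k n (D i) z))\<^sup>2)"
  have contW: "continuous_on S W" and contV: "continuous_on S V" for S
    unfolding W_def V_def by (intro continuous_intros)+
  have z0: "z0 \<in> ?K"
    using \<open>\<eta> > 0\<close> by (intro center_in_polydisc) simp
  have line: "biform k n (\<lambda>a b. (1 - s) * C0 i a b + s * C1 i a b) z
      = biform k n (C0 i) z + s * biform k n (D i) z" for s i z
    using biform_linear[of k n 1 "C0 i" s "D i" z] by (simp add: D_def algebra_simps)
  define Bd where "Bd = (\<Union>j\<in>J. {z \<in> ?K. cmod (z j - z0 j) = \<eta>})"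
  have "compact {z \<in> ?K. cmod (z j - z0 j) = \<eta>}" for j
  proof -
    have "continuous_on UNIV (\<lambda>z :: nat + nat \<Rightarrow> complex. cmod (z j - z0 j))"
      by (intro continuous_intros continuous_on_product_coordinates)
    then have "closed ((\<lambda>z. cmod (z j - z0 j)) -` {\<eta>})"
      by (intro closed_vimage) auto
    then have "compact (?K \<inter> (\<lambda>z. cmod (z j - z0 j)) -` {\<eta>})"
      using compact_polydisc by (rule compact_Int_closed[rotated])
    also have "?K \<inter> (\<lambda>z. cmod (z j - z0 j)) -` {\<eta>} = {z \<in> ?K. cmod (z j - z0 j) = \<eta>}"
      by auto
    finally show ?thesis .
  qed
  then have "compact Bd"
    unfolding Bd_def using \<open>finite J\<close> by (intro compact_UN)
  have "\<exists>\<delta>>0. \<forall>z\<in>Bd. \<delta> \<le> W z"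
  proof (cases "Bd = {}")
    case False
    then obtain z1 where z1: "z1 \<in> Bd" "\<forall>z\<in>Bd. W z1 \<le> W z"
      using continuous_attains_inf[OF \<open>compact Bd\<close> _ contW] by auto
    then have "z1 \<in> ?K" "z1 \<noteq> z0"
      using \<open>\<eta> > 0\<close> by (auto simp: Bd_def)
    then obtain i where "i < N" "biform k n (C0 i) z1 \<noteq> 0"
      using only[of z1] by auto
    then have "W z1 > 0"
      unfolding W_def by (intro sum_pos2[of _ i]) auto
    then show ?thesis
      using z1(2) by auto
  qed (auto intro: exI[of _ 1])
  then obtain \<delta> where \<delta>: "\<delta> > 0" "\<And>z. z \<in> Bd \<Longrightarrow> \<delta> \<le> W z"
    by auto
  have "compact (V ` ?K)"
    using compact_polydisc contV by (intro compact_continuous_image)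
  then have "bounded (V ` ?K)"
    by (rule compact_imp_bounded)
  then obtain M where "\<forall>z\<in>?K. \<bar>V z\<bar> \<le> M"
    by (auto simp: bounded_iff)
  then have M: "V z \<le> M" if "z \<in> ?K" for z
    using that by (auto dest: bspec)
  have "M \<ge> 0"
    using M[OF z0] by (smt (verit) V_def sum_nonneg zero_le_power2)
  have "((\<lambda>s :: complex. (cmod s)\<^sup>2 * (4 * (M + 1))) \<longlongrightarrow> (cmod 0)\<^sup>2 * (4 * (M + 1))) (at 0)"
    by (intro tendsto_intros)
  then have "\<forall>\<^sub>F s :: complex in at 0. (cmod s)\<^sup>2 * (4 * (M + 1)) < \<delta>"
    using \<delta>(1) by (auto dest: order_tendstoD(2))
  then show ?thesis
  proof eventually_elim
    case (elim s)
    define x where "x = (cmod s)\<^sup>2 * M"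
    have "(cmod s)\<^sup>2 * (4 * (M + 1)) = 4 * x + 4 * (cmod s)\<^sup>2"
      by (simp add: x_def algebra_simps)
    then have x: "4 * x < \<delta>"
      using elim zero_le_power2[of "cmod s"] by linarith
    let ?C = "\<lambda>i a b. (1 - s) * C0 i a b + s * C1 i a b"
    let ?Ws = "\<lambda>z. \<Sum>i<N. (cmod (biform k n (?C i) z))\<^sup>2"
    \<comment> \<open>The perturbed squared norm is at most \<open>x\<close> at the center and at
      least \<open>\<delta> / 2 - x\<close> on the boundary, the latter by |u - v|^2 \<le> 2|u|^2 +
      2|v|^2. These are separated because \<open>4 * x < \<delta>\<close>.\<close>
    show ?case
    proof (rule square_system_has_zero[of J N \<eta> k n ?C z0 "\<delta> / 2 - x"])
      have "?Ws z0 = (cmod s)\<^sup>2 * V z0"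
        unfolding line V_def sum_distrib_left by (simp add: zero norm_mult power_mult_distrib)
      also have "\<dots> \<le> x"
        unfolding x_def using M[OF z0] by (intro mult_left_mono) auto
      finally show "?Ws z0 < \<delta> / 2 - x"
        using x by linarith
    next
      fix z j assume z: "z \<in> ?K" "j \<in> J" "cmod (z j - z0 j) = \<eta>"
      have "(cmod (biform k n (C0 i) z))\<^sup>2
          \<le> 2 * (cmod (biform k n (?C i) z))\<^sup>2 + 2 * ((cmod s)\<^sup>2 * (cmod (biform k n (D i) z))\<^sup>2)" for i
      proof -
        have "cmod (biform k n (C0 i) z) \<le> cmod (biform k n (?C i) z) + cmod s * cmod (biform k n (D i) z)"
          unfolding line norm_mult[symmetric] by (rule order_trans[OF _ norm_triangle_ineq4]) simp
        then have "(cmod (biform k n (C0 i) z))\<^sup>2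
            \<le> (cmod (biform k n (?C i) z) + cmod s * cmod (biform k n (D i) z))\<^sup>2"
          by (intro power_mono) auto
        also have "\<dots> \<le> 2 * (cmod (biform k n (?C i) z))\<^sup>2 + 2 * (cmod s * cmod (biform k n (D i) z))\<^sup>2"
          using sum_squares_bound[of "cmod (biform k n (?C i) z)" "cmod s * cmod (biform k n (D i) z)"]
          by (simp add: power2_sum)
        finally show ?thesis
          by (simp add: power_mult_distrib)
      qed
      then have "W z \<le> (\<Sum>i<N. 2 * (cmod (biform k n (?C i) z))\<^sup>2 + 2 * ((cmod s)\<^sup>2 * (cmod (biform k n (D i) z))\<^sup>2))"
        unfolding W_def by (intro sum_mono)
      also have "\<dots> = 2 * ?Ws z + 2 * ((cmod s)\<^sup>2 * V z)"
        by (simp add: sum.distrib sum_distrib_left V_def)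
      also have "(cmod s)\<^sup>2 * V z \<le> x"
        unfolding x_def using M[OF z(1)] by (intro mult_left_mono) auto
      finally have "W z \<le> 2 * ?Ws z + 2 * x"
        by simp
      moreover have "z \<in> Bd"
        using z by (auto simp: Bd_def)
      ultimately show "\<delta> / 2 - x \<le> ?Ws z"
        using \<delta>(2)[of z] by linarith
    qed (use assms in auto)
  qed
qed

section \<open>Counting isolated zeros on a general member of the line\<close>

lemma polydisc_mono: "\<eta> \<le> \<eta>' \<Longrightarrow> polydisc J z0 \<eta> \<subseteq> polydisc J z0 \<eta>'"
  by (fastforce simp: polydisc_def)

text \<open>The coordinates that remain after fixing \<open>z (Inl k) = 1\<close> and \<open>z (Inr b) = 1\<close>.\<close>

definition chart_coords :: "nat \<Rightarrow> nat \<Rightarrow> nat \<Rightarrow> (nat + nat) set"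
  where "chart_coords k n b = Inl ` {..<k} \<union> Inr ` ({..<n} - {b})"

lemma chart_coords:
  assumes "Suc N = n + k" "b < n"
  shows "finite (chart_coords k n b)" "card (chart_coords k n b) = N"
proof -
  have "card (chart_coords k n b) = card (Inl ` {..<k} :: (nat + nat) set) + card (Inr ` ({..<n} - {b}) :: (nat + nat) set)"
    unfolding chart_coords_def by (intro card_Un_disjoint) auto
  then show "card (chart_coords k n b) = N"
    using assms by (simp add: card_image)
qed (simp add: chart_coords_def)

text \<open>Each zero persists within distance \<open>\<eta>\<close> per coordinate, and parameters
  more than \<open>2 * \<eta>\<close> apart stay different, so a general member of the line has at
  least \<open>card P\<close> zeros with different parameters. The chart depends on the zero, as no
  single vector entry need be nonzero at all of them.\<close>

lemma isolated_zeros_bound: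
  fixes C0 :: "nat \<Rightarrow> nat \<Rightarrow> nat \<Rightarrow> complex"
  assumes N: "Suc N = n + k" and "finite P"
    and chart: "\<And>z. z \<in> P \<Longrightarrow> b z < n \<and> z (Inl k) = 1 \<and> z (Inr (b z)) = 1"
    and zero: "\<And>z i. z \<in> P \<Longrightarrow> i < N \<Longrightarrow> biform k n (C0 i) z = 0"
    and only: "\<And>z. z \<in> P \<Longrightarrow> \<exists>\<eta>>0. \<forall>w\<in>polydisc (chart_coords k n (b z)) z \<eta>.
      (\<forall>i<N. biform k n (C0 i) w = 0) \<longrightarrow> w = z"
    and sep: "\<And>z w. z \<in> P \<Longrightarrow> w \<in> P \<Longrightarrow> z \<noteq> w \<Longrightarrow> \<exists>a<k. z (Inl a) \<noteq> w (Inl a)"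
  shows "card P \<le> N choose k"
proof -
  let ?C = "\<lambda>s i a b. (1 - s) * C0 i a b + s * (of_nat i ^ a * of_nat i ^ b)"
  let ?J = "\<lambda>z. chart_coords k n (b z)"
  obtain X where X: "finite X" "\<And>s P. s \<notin> X \<and> finite P \<and>
    (\<forall>z\<in>P. z (Inl k) = 1 \<and> (\<exists>b<n. z (Inr b) \<noteq> 0) \<and> (\<forall>i<N. biform k n (?C s i) z = 0)) \<and>
    (\<forall>z\<in>P. \<forall>w\<in>P. z \<noteq> w \<longrightarrow> (\<exists>a\<le>k. z (Inl a) \<noteq> w (Inl a))) \<Longrightarrow> card P \<le> N choose k"
    using few_zeros_on_generic_system[OF N, of C0] by auto
  have "\<forall>\<^sub>F \<eta> in at_right 0. (\<forall>w\<in>polydisc (?J z) z \<eta>. (\<forall>i<N. biform k n (C0 i) w = 0) \<longrightarrow> w = z)"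
    if "z \<in> P" for z
  proof -
    obtain e where e: "e > 0" "\<forall>w\<in>polydisc (?J z) z e. (\<forall>i<N. biform k n (C0 i) w = 0) \<longrightarrow> w = z"
      using only[OF \<open>z \<in> P\<close>] by auto
    show ?thesis
      using eventually_at_right_less[of 0] eventually_at_right_real[OF e(1)]
    proof eventually_elim
      case (elim \<eta>)
      then show ?case
        using e(2) polydisc_mono[of \<eta> e "?J z" z] by (auto simp: subset_iff)
    qed
  qed
  moreover have "\<forall>\<^sub>F \<eta> in at_right 0. \<forall>w\<in>P. z \<noteq> w \<longrightarrow> (\<exists>a<k. 2 * \<eta> < cmod (z (Inl a) - w (Inl a)))"
    if "z \<in> P" for z
  proof (intro eventually_ball_finite \<open>finite P\<close> ballI)
    fix w assume "w \<in> P"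
    show "\<forall>\<^sub>F \<eta> in at_right 0. z \<noteq> w \<longrightarrow> (\<exists>a<k. 2 * \<eta> < cmod (z (Inl a) - w (Inl a)))"
    proof (cases "z = w")
      case False
      then obtain a where a: "a < k" "z (Inl a) \<noteq> w (Inl a)"
        using sep \<open>z \<in> P\<close> \<open>w \<in> P\<close> by auto
      then have "0 < cmod (z (Inl a) - w (Inl a)) / 2"
        by simp
      from eventually_at_right_real[OF this] show ?thesis
        by eventually_elim (use a(1) in auto)
    qed simp
  qed
  ultimately have ev: "\<forall>\<^sub>F \<eta> in at_right (0 :: real). 0 < \<eta> \<and>
      (\<forall>z\<in>P. \<forall>w\<in>polydisc (?J z) z \<eta>. (\<forall>i<N. biform k n (C0 i) w = 0) \<longrightarrow> w = z) \<and>
      (\<forall>z\<in>P. \<forall>w\<in>P. z \<noteq> w \<longrightarrow> (\<exists>a<k. 2 * \<eta> < cmod (z (Inl a) - w (Inl a))))"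
    using \<open>finite P\<close> by (intro eventually_conj eventually_ball_finite eventually_at_right_less) auto
  from eventually_happens'[OF trivial_limit_at_right_real ev] obtain \<eta> :: real where \<eta>: "0 < \<eta>"
      "\<forall>z\<in>P. \<forall>w\<in>polydisc (?J z) z \<eta>. (\<forall>i<N. biform k n (C0 i) w = 0) \<longrightarrow> w = z"
      "\<forall>z\<in>P. \<forall>w\<in>P. z \<noteq> w \<longrightarrow> (\<exists>a<k. 2 * \<eta> < cmod (z (Inl a) - w (Inl a)))"
    by auto
  have "\<forall>\<^sub>F s in at 0. \<forall>z\<in>P. \<exists>w\<in>polydisc (?J z) z \<eta>. \<forall>i<N. biform k n (?C s i) w = 0"
  proof (intro eventually_ball_finite \<open>finite P\<close> ballI)
    fix z assume z: "z \<in> P"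
    show "\<forall>\<^sub>F s in at 0. \<exists>w\<in>polydisc (?J z) z \<eta>. \<forall>i<N. biform k n (?C s i) w = 0"
    proof (rule isolated_zero_persists[OF chart_coords[OF N] \<eta>(1)])
      show "b z < n" "b z < n"
        using chart[OF z] by auto
      show "w = z" if "w \<in> polydisc (?J z) z \<eta>" "\<forall>i<N. biform k n (C0 i) w = 0" for w
        using \<eta>(2) z that by auto
    qed (rule zero[OF z])
  qed
  \<comment> \<open>\<open>0\<close> itself may be exceptional when the original system is
    degenerate; a punctured neighbourhood avoids the finite set.\<close>
  moreover have "\<forall>\<^sub>F s in at 0. s \<notin> X"
    using islimpt_finite[OF \<open>finite X\<close>] by (simp add: islimpt_iff_eventually)
  ultimately have ev: "\<forall>\<^sub>F s in at 0. s \<notin> X \<and>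
      (\<forall>z\<in>P. \<exists>w\<in>polydisc (?J z) z \<eta>. \<forall>i<N. biform k n (?C s i) w = 0)"
    by (rule eventually_conj[rotated])
  from eventually_happens'[OF at_neq_bot ev]
  obtain s where s: "s \<notin> X" "\<forall>z\<in>P. \<exists>w. w \<in> polydisc (?J z) z \<eta> \<and> (\<forall>i<N. biform k n (?C s i) w = 0)"
    by (auto simp: Bex_def)
  from bchoice[OF s(2)] obtain f where
    f: "\<forall>z\<in>P. f z \<in> polydisc (?J z) z \<eta> \<and> (\<forall>i<N. biform k n (?C s i) (f z) = 0)" ..
  have close: "cmod (f z (Inl a) - z (Inl a)) \<le> \<eta>" if "z \<in> P" "a < k" for z a
    using f that by (auto simp: polydisc_def chart_coords_def)
  have f_sep: "\<exists>a<k. f z (Inl a) \<noteq> f w (Inl a)" if zw: "z \<in> P" "w \<in> P" "z \<noteq> w" for z w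
  proof -
    obtain a where a: "a < k" "2 * \<eta> < cmod (z (Inl a) - w (Inl a))"
      using \<eta>(3) zw by auto
    have "f z (Inl a) \<noteq> f w (Inl a)"
    proof
      assume eq: "f z (Inl a) = f w (Inl a)"
      have "cmod (z (Inl a) - w (Inl a)) = cmod ((f w (Inl a) - w (Inl a)) - (f z (Inl a) - z (Inl a)))"
        by (simp add: eq)
      also have "\<dots> \<le> \<eta> + \<eta>"
        by (intro order_trans[OF norm_triangle_ineq4] add_mono close zw a(1))
      finally show False
        using a(2) by simp
    qed
    then show ?thesis
      using a(1) by auto
  qed
  have "inj_on f P"
    by (rule inj_onI) (use f_sep in fastforce)
  then have "card P = card (f ` P)"
    by (simp add: card_image)
  also have "\<dots> \<le> N choose k"
  proof (rule X(2)[of s], intro conjI ballI impI)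
    show "s \<notin> X" "finite (f ` P)"
      using s \<open>finite P\<close> by auto
    fix w assume "w \<in> f ` P"
    then obtain z where z: "z \<in> P" "w = f z"
      by auto
    have "w \<in> polydisc (?J z) z \<eta>"
      using f z by auto
    then have "w (Inl k) = 1" "w (Inr (b z)) = 1"
      using chart[OF z(1)] by (auto simp: polydisc_def chart_coords_def)
    then show "w (Inl k) = 1" "\<exists>b<n. w (Inr b) \<noteq> 0"
      using chart[OF z(1)] by (auto intro!: exI[of _ "b z"])
    show "\<forall>i<N. biform k n (?C s i) w = 0"
      using f z by auto
    fix w' assume "w' \<in> f ` P" "w \<noteq> w'"
    then obtain z' where z': "z' \<in> P" "w' = f z'" "z \<noteq> z'"
      using z(2) by auto
    then show "\<exists>a\<le>k. w (Inl a) \<noteq> w' (Inl a)"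
      using f_sep[OF z(1) z'(1,3)] z(2) z'(2) by (auto intro: less_imp_le)
  qed
  finally show ?thesis .
qed

section \<open>The eigenvalue problem as a rectangular multiparameter problem\<close>

lemma scalar_product_scale: "scalar_product v (c *s x) = c * scalar_product v (x :: complex ^ 'n)"
  by (simp add: scalar_product_def sum_distrib_left mult.left_commute)

lemma scalar_product_add: "scalar_product v (x + y) = scalar_product v x + scalar_product v (y :: complex ^ 'n)"
  by (simp add: scalar_product_def sum.distrib algebra_simps)

lemma scalar_product_minus_left: "scalar_product (- v) x = - scalar_product v (x :: complex ^ 'n)"
  by (simp add: scalar_product_def sum_negf)

lemma continuous_on_scalar_product: "continuous_on S (scalar_product (v :: complex ^ 'n))"
  unfolding scalar_product_def by (intro continuous_intros)

lemma matrix_vector_mult_nth: "(M *v x) $ j = scalar_product (M $ j) (x :: complex ^ 'n)"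
  by (simp add: matrix_vector_mult_def scalar_product_def)

lemma nep_matrix_mult_nth:
  "(nep_matrix m A B C r s lam x *v y) $ j = scalar_product (A $ j) y + lam * scalar_product (B $ j) y
    + (\<Sum>l=1..m. scalar_product (r l) x / scalar_product (s l) x * scalar_product (C l $ j) y)"
proof -
  let ?q = "\<lambda>l. scalar_product (r l) x / scalar_product (s l) x"
  have "(\<Sum>i\<in>UNIV. (\<Sum>l=1..m. ?q l * C l $ j $ i) * y $ i)
      = (\<Sum>l=1..m. ?q l * (\<Sum>i\<in>UNIV. C l $ j $ i * y $ i))"
    unfolding sum_distrib_left sum_distrib_right by (subst sum.swap) (simp add: mult.assoc)
  then show ?thesis
    unfolding matrix_vector_mult_nth
    by (simp add: nep_matrix_def map_matrix_def scalar_product_def distrib_right sum.distrib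
        sum_distrib_left mult.assoc)
qed

lemma is_nep_solution_scale:
  assumes "c \<noteq> 0" "is_nep_solution m A B C r s lam x"
  shows "is_nep_solution m A B C r s lam (c *s x)"
proof -
  have "nep_matrix m A B C r s lam (c *s x) = nep_matrix m A B C r s lam x"
    using assms(1) by (simp add: nep_matrix_def scalar_product_scale)
  then show ?thesis
    using assms by (simp add: is_nep_solution_def scalar_product_scale vector_scalar_commute
        flip: scalar_matrix_assoc)
qed

text \<open>
  With \<open>\<mu>\<^sub>l = r\<^sub>l\<^sup>T x / s\<^sub>l\<^sup>T x\<close> as additional unknowns the problem consists of the \<open>n\<close> rows of
  \<open>(A + \<lambda> B + \<mu>\<^sub>1 C\<^sub>1 + \<dots> + \<mu>\<^sub>m C\<^sub>m) x = 0\<close> and the \<open>m\<close> equations \<open>(r\<^sub>l - \<mu>\<^sub>l s\<^sub>l)\<^sup>T x = 0\<close>. Parameter \<open>0\<close> is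
  \<open>\<lambda>\<close>, parameters \<open>1, \<dots>, m\<close> are the \<open>\<mu>\<^sub>l\<close>, and parameter \<open>m + 1\<close> is the homogenizing one.
\<close>

definition nep_rows ::
  "nat \<Rightarrow> complex ^ 'n ^ 'n \<Rightarrow> complex ^ 'n ^ 'n \<Rightarrow> (nat \<Rightarrow> complex ^ 'n ^ 'n) \<Rightarrow>
   (nat \<Rightarrow> complex ^ 'n) \<Rightarrow> (nat \<Rightarrow> complex ^ 'n) \<Rightarrow> (nat \<Rightarrow> 'n) \<Rightarrow> nat \<Rightarrow> nat \<Rightarrow> complex ^ 'n"
  where "nep_rows m A B C r s e i a =
    (if i < CARD('n) then (if a = 0 then B $ e i else if a \<le> m then C a $ e i else A $ e i)
     else if a = Suc i - CARD('n) then - s a else if a = Suc m then r (Suc i - CARD('n)) else 0)"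

definition nep_biform ::
  "nat \<Rightarrow> complex ^ 'n ^ 'n \<Rightarrow> complex ^ 'n ^ 'n \<Rightarrow> (nat \<Rightarrow> complex ^ 'n ^ 'n) \<Rightarrow>
   (nat \<Rightarrow> complex ^ 'n) \<Rightarrow> (nat \<Rightarrow> complex ^ 'n) \<Rightarrow> (nat \<Rightarrow> 'n) \<Rightarrow> nat \<Rightarrow> (nat + nat \<Rightarrow> complex) \<Rightarrow> complex"
  where "nep_biform m A B C r s e i =
    biform (Suc m) CARD('n) (\<lambda>a b. nep_rows m A B C r s e i a $ e b)"

definition vec_of_point :: "(nat \<Rightarrow> 'n) \<Rightarrow> (nat + nat \<Rightarrow> complex) \<Rightarrow> complex ^ 'n"
  where "vec_of_point e z = (\<chi> j. z (Inr (inv_into {..<CARD('n)} e j)))"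

text \<open>The values at indices out of range are the same for all solutions and stay frozen in
  \<open>polydisc\<close>, so points agree as functions once they agree in the coordinates of the
  problem.\<close>

definition nep_point ::
  "nat \<Rightarrow> (nat \<Rightarrow> complex ^ 'n) \<Rightarrow> (nat \<Rightarrow> complex ^ 'n) \<Rightarrow> (nat \<Rightarrow> 'n) \<Rightarrow> complex \<Rightarrow> complex ^ 'n \<Rightarrow> nat + nat \<Rightarrow> complex"
  where "nep_point m r s e lam x = case_sum
    (\<lambda>a. if a = 0 then lam else if a \<le> m then scalar_product (r a) x / scalar_product (s a) x else 1)
    (\<lambda>b. if b < CARD('n) then x $ e b else 0)"

lemma vec_of_point_nth:
  fixes e :: "nat \<Rightarrow> 'n :: finite"
  assumes "bij_betw e {..<CARD('n)} UNIV" "b < CARD('n)"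
  shows "vec_of_point e z $ e b = z (Inr b)"
  using assms unfolding vec_of_point_def by (simp add: bij_betw_inv_into_left)

lemma vec_of_nep_point:
  fixes e :: "nat \<Rightarrow> 'n :: finite"
  assumes "bij_betw e {..<CARD('n)} UNIV"
  shows "vec_of_point e (nep_point m r s e lam x) = x"
proof -
  have "inv_into {..<CARD('n)} e j < CARD('n)" "e (inv_into {..<CARD('n)} e j) = j" for j
    using bij_betwE[OF bij_betw_inv_into[OF assms]] bij_betw_inv_into_right[OF assms] by auto
  then show ?thesis
    by (simp add: vec_of_point_def nep_point_def vec_eq_iff)
qed

lemma biform_rows:
  fixes e :: "nat \<Rightarrow> 'n :: finite"
  assumes "bij_betw e {..<CARD('n)} UNIV"
  shows "biform k CARD('n) (\<lambda>a b. d a $ e b) z = (\<Sum>a<Suc k. z (Inl a) * scalar_product (d a) (vec_of_point e z))"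
  unfolding biform_def
proof (rule sum.cong)
  fix a
  have "(\<Sum>b<CARD('n). d a $ e b * z (Inl a) * z (Inr b))
      = (\<Sum>b<CARD('n). z (Inl a) * (d a $ e b * vec_of_point e z $ e b))"
    by (intro sum.cong) (simp_all add: vec_of_point_nth[OF assms])
  then show "(\<Sum>b<CARD('n). d a $ e b * z (Inl a) * z (Inr b))
      = z (Inl a) * scalar_product (d a) (vec_of_point e z)"
    unfolding scalar_product_def sum_distrib_left
    using sum.reindex_bij_betw[OF assms, of "\<lambda>j. z (Inl a) * (d a $ j * vec_of_point e z $ j)"] by simp
qed simp

lemma sum_split_first_last: "(\<Sum>a<Suc (Suc m). f a) = f 0 + (\<Sum>l=1..m. f l) + (f (Suc m) :: complex)"
  by (simp add: lessThan_Suc_atMost atMost_atLeast0 sum.atLeast_Suc_atMost)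

lemma nep_biform_matrix_row:
  fixes e :: "nat \<Rightarrow> 'n :: finite"
  assumes "bij_betw e {..<CARD('n)} UNIV" "z (Inl (Suc m)) = 1" "i < CARD('n)"
  shows "nep_biform m A B C r s e i z = scalar_product (A $ e i) (vec_of_point e z)
    + z (Inl 0) * scalar_product (B $ e i) (vec_of_point e z)
    + (\<Sum>l=1..m. z (Inl l) * scalar_product (C l $ e i) (vec_of_point e z))"
proof -
  have "nep_rows m A B C r s e i 0 = B $ e i" "nep_rows m A B C r s e i (Suc m) = A $ e i"
    using assms(3) by (simp_all add: nep_rows_def)
  moreover have "(\<Sum>l=1..m. z (Inl l) * scalar_product (nep_rows m A B C r s e i l) (vec_of_point e z))
      = (\<Sum>l=1..m. z (Inl l) * scalar_product (C l $ e i) (vec_of_point e z))"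
    using assms(3) by (intro sum.cong) (auto simp: nep_rows_def)
  ultimately show ?thesis
    unfolding nep_biform_def biform_rows[OF assms(1)] sum_split_first_last by (simp only: assms(2)) simp
qed

lemma nep_biform_quotient_row:
  fixes e :: "nat \<Rightarrow> 'n :: finite"
  assumes "bij_betw e {..<CARD('n)} UNIV" "z (Inl (Suc m)) = 1" "l \<in> {1..m}"
  shows "nep_biform m A B C r s e (CARD('n) + l - 1) z
    = scalar_product (r l) (vec_of_point e z) - z (Inl l) * scalar_product (s l) (vec_of_point e z)"
proof -
  let ?x = "vec_of_point e z"
  have row: "nep_rows m A B C r s e (CARD('n) + l - 1) a = (if a = l then - s l else if a = Suc m then r l else 0)" for a
    using assms(3) by (auto simp: nep_rows_def)
  have "(\<Sum>a=1..m. z (Inl a) * scalar_product (if a = l then - s l else if a = Suc m then r l else 0) ?x)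
      = (\<Sum>a=1..m. if a = l then - z (Inl l) * scalar_product (s l) ?x else 0)"
    by (intro sum.cong) (auto simp: scalar_product_minus_left, simp add: scalar_product_def)
  then show ?thesis
    unfolding nep_biform_def biform_rows[OF assms(1)] sum_split_first_last row
    using assms(2,3) by (auto simp: scalar_product_def)
qed

text \<open>Where the denominators are nonzero, the quotient rows determine the parameters, and
  inserting these turns the matrix rows into the eigenvalue equation. The bilinear system may have
  further zeros at which a denominator vanishes.\<close>

lemma nep_biform_zero_iff:
  fixes e :: "nat \<Rightarrow> 'n :: finite"
  assumes e: "bij_betw e {..<CARD('n)} UNIV" and z: "z (Inl (Suc m)) = 1"
    and s: "\<And>l. l \<in> {1..m} \<Longrightarrow> scalar_product (s l) (vec_of_point e z) \<noteq> 0"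
  shows "(\<forall>i<CARD('n) + m. nep_biform m A B C r s e i z = 0) \<longleftrightarrow>
    nep_matrix m A B C r s (z (Inl 0)) (vec_of_point e z) *v vec_of_point e z = 0 \<and>
    (\<forall>l\<in>{1..m}. z (Inl l) = scalar_product (r l) (vec_of_point e z) / scalar_product (s l) (vec_of_point e z))"
    (is "?L \<longleftrightarrow> ?M \<and> ?Q")
proof -
  have quot: "nep_biform m A B C r s e (CARD('n) + l - 1) z = 0 \<longleftrightarrow>
      z (Inl l) = scalar_product (r l) (vec_of_point e z) / scalar_product (s l) (vec_of_point e z)"
    if "l \<in> {1..m}" for l
    unfolding nep_biform_quotient_row[where z = z and m = m, OF e z that] nonzero_eq_divide_eq[OF s[OF that]] by auto
  have mat: "nep_biform m A B C r s e i z
      = (nep_matrix m A B C r s (z (Inl 0)) (vec_of_point e z) *v vec_of_point e z) $ e i"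
    if ?Q "i < CARD('n)" for i
    unfolding nep_biform_matrix_row[where z = z and m = m, OF e z that(2)] nep_matrix_mult_nth using that(1) by simp
  show ?thesis
  proof
    assume L: ?L
    have Q: ?Q
    proof
      fix l assume l: "l \<in> {1..m}"
      then have "CARD('n) + l - 1 < CARD('n) + m"
        by auto
      then show "z (Inl l) = scalar_product (r l) (vec_of_point e z) / scalar_product (s l) (vec_of_point e z)"
        using L quot[OF l] by auto
    qed
    have "(nep_matrix m A B C r s (z (Inl 0)) (vec_of_point e z) *v vec_of_point e z) $ j = 0" for j
    proof -
      obtain i where "i < CARD('n)" "j = e i"
        using bij_betw_imp_surj_on[OF e] by (metis UNIV_I imageE lessThan_iff)
      then show ?thesis
        using L mat[OF Q, of i] by simp
    qed
    then show "?M \<and> ?Q"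
      using Q by (simp add: vec_eq_iff)
  next
    assume MQ: "?M \<and> ?Q"
    show ?L
    proof (intro allI impI)
      fix i assume i: "i < CARD('n) + m"
      show "nep_biform m A B C r s e i z = 0"
      proof (cases "i < CARD('n)")
        case True
        then show ?thesis
          using MQ mat[of i] by simp
      next
        case False
        \<comment> \<open>The quotient rows start at index \<open>CARD('n)\<close>, which belongs to
          \<open>l = 1\<close>.\<close>
        define l where "l = Suc i - CARD('n)"
        have l: "l \<in> {1..m}" "i = CARD('n) + l - 1"
          using False i by (auto simp: l_def)
        then show ?thesis
          using MQ quot[OF l(1)] by auto
      qed
    qed
  qed
qed

lemma nep_biform_nep_point:
  fixes e :: "nat \<Rightarrow> 'n :: finite"
  assumes e: "bij_betw e {..<CARD('n)} UNIV" and sol: "is_nep_solution m A B C r s lam x"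
  shows "\<forall>i<CARD('n) + m. nep_biform m A B C r s e i (nep_point m r s e lam x) = 0"
proof -
  have "nep_point m r s e lam x (Inl 0) = lam" "nep_point m r s e lam x (Inl (Suc m)) = 1"
    "\<forall>l\<in>{1..m}. nep_point m r s e lam x (Inl l) = scalar_product (r l) x / scalar_product (s l) x"
    by (auto simp: nep_point_def)
  then show ?thesis
    using nep_biform_zero_iff[OF e, of "nep_point m r s e lam x" m s A B C r] sol
    unfolding vec_of_nep_point[OF e] is_nep_solution_def by simp
qed

text \<open>Openness in the quotient topology becomes a metric statement about representatives. The
  radius also keeps the denominators nonzero, so that nearby zeros of the bilinear system are
  genuine solutions.\<close>

lemma nep_isolated_neighbourhood:
  fixes x :: "complex ^ 'n"
  assumes iso: "(lam, proj_point x) isolated_in nep_solutions m A B C r s"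
    and sol: "is_nep_solution m A B C r s lam x"
  shows "\<exists>d>0. \<forall>l y. cmod (l - lam) < d \<longrightarrow> dist y x < d \<longrightarrow>
    y \<noteq> 0 \<and> (\<forall>i\<in>{1..m}. scalar_product (s i) y \<noteq> 0) \<and>
    (is_nep_solution m A B C r s l y \<longrightarrow> l = lam \<and> (\<exists>\<alpha>. y = \<alpha> *s x))"
proof -
  let ?S = "nep_solutions m A B C r s"
  obtain T where T: "open T" "T \<inter> ?S = {(lam, proj_point x)}"
    using iso unfolding isolated_in_def by auto
  then have "(lam, proj_point x) \<in> T"
    by auto
  with T(1) obtain U V where UV: "open U" "open V" "lam \<in> U" "proj_point x \<in> V" "U \<times> V \<subseteq> T"
    by (rule open_prod_elim) auto
  have x: "x \<noteq> 0" "\<forall>i\<in>{1..m}. scalar_product (s i) x \<noteq> 0"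
    using sol by (auto simp: is_nep_solution_def)
  have "open {y. scalar_product (s i) y \<noteq> 0}" for i
    by (intro open_Collect_neq continuous_on_scalar_product continuous_on_const)
  then have "open (\<Inter>i\<in>{1..m}. {y. scalar_product (s i) y \<noteq> 0})"
    by (intro open_INT) auto
  moreover have "open {y. y \<noteq> 0 \<and> proj_point y \<in> V}"
    using UV(2) by (simp add: open_proj_space_def)
  ultimately have "open ({y. y \<noteq> 0 \<and> proj_point y \<in> V} \<inter> (\<Inter>i\<in>{1..m}. {y. scalar_product (s i) y \<noteq> 0}))"
    (is "open ?O") by (rule open_Int[rotated])
  moreover have "x \<in> ?O"
    using x UV(4) by auto
  ultimately obtain d1 where d1: "d1 > 0" "\<forall>y. dist y x < d1 \<longrightarrow> y \<in> ?O"
    unfolding open_dist by (auto dest!: bspec[of _ _ x])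
  obtain d2 where d2: "d2 > 0" "\<forall>l. dist l lam < d2 \<longrightarrow> l \<in> U"
    using bspec[OF UV(1)[unfolded open_dist] UV(3)] by auto
  show ?thesis
  proof (intro exI[of _ "min d1 d2"] conjI allI impI)
    fix l y assume l: "cmod (l - lam) < min d1 d2" and y: "dist y x < min d1 d2"
    have "y \<in> ?O"
      using d1(2)[rule_format, of y] y by (simp only: min_less_iff_conj)
    then show y0: "y \<noteq> 0" and "\<forall>i\<in>{1..m}. scalar_product (s i) y \<noteq> 0"
      by auto
    have V: "proj_point y \<in> V"
      using \<open>y \<in> ?O\<close> by auto
    have "l \<in> U"
      using d2(2) l by (simp add: dist_norm)
    assume "is_nep_solution m A B C r s l y"
    then have "(l, proj_point y) \<in> T \<inter> ?S"
      using V \<open>l \<in> U\<close> UV(5) unfolding nep_solutions_def by auto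
    then have eq: "l = lam" "proj_point x = proj_point y"
      using T(2) by auto
    then show "l = lam" "\<exists>\<alpha>. y = \<alpha> *s x"
      using proj_point_eq_iff[OF x(1) y0] by auto
  qed (use d1 d2 in auto)
qed

lemma nep_normalized_solution:
  fixes e :: "nat \<Rightarrow> 'n :: finite"
  assumes e: "bij_betw e {..<CARD('n)} UNIV" and "p \<in> nep_solutions m A B C r s"
  shows "\<exists>lam x b. p = (lam, proj_point x) \<and> is_nep_solution m A B C r s lam x \<and> b < CARD('n) \<and> x $ e b = 1"
proof -
  obtain lam y where y: "p = (lam, proj_point y)" "is_nep_solution m A B C r s lam y"
    using assms(2) unfolding nep_solutions_def by auto
  then have "y \<noteq> 0"
    by (simp add: is_nep_solution_def)
  then obtain j where j: "y $ j \<noteq> 0"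
    by (auto simp: vec_eq_iff)
  have "j \<in> e ` {..<CARD('n)}"
    using bij_betw_imp_surj_on[OF e] by simp
  then obtain b where b: "b < CARD('n)" "j = e b"
    by auto
  define x where "x = inverse (y $ j) *s y"
  have sol: "is_nep_solution m A B C r s lam x"
    unfolding x_def using j by (intro is_nep_solution_scale y(2)) simp
  then have "x \<noteq> 0"
    by (simp add: is_nep_solution_def)
  then have "proj_point y = proj_point x"
    using proj_point_eq_iff[OF \<open>y \<noteq> 0\<close>] j by (auto simp: x_def)
  moreover have "x $ e b = 1"
    using j by (simp add: x_def b)
  ultimately show ?thesis
    using y(1) sol b(1) by auto
qed

text \<open>A zero near the point gives a solution near \<open>x\<close>, hence a multiple of
  \<open>x\<close> with the same \<open>lam\<close>. The entry \<open>b\<close>, frozen at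
  \<open>1\<close>, fixes the multiple, and the quotient rows recover the other parameters.\<close>

lemma nep_point_isolated:
  fixes e :: "nat \<Rightarrow> 'n :: finite"
  assumes e: "bij_betw e {..<CARD('n)} UNIV"
    and iso: "(lam, proj_point x) isolated_in nep_solutions m A B C r s"
    and sol: "is_nep_solution m A B C r s lam x" and b: "b < CARD('n)" "x $ e b = 1"
  shows "\<exists>\<eta>>0. \<forall>w\<in>polydisc (chart_coords (Suc m) CARD('n) b) (nep_point m r s e lam x) \<eta>.
    (\<forall>i<CARD('n) + m. nep_biform m A B C r s e i w = 0) \<longrightarrow> w = nep_point m r s e lam x"
proof -
  let ?z = "nep_point m r s e lam x"
  obtain d where d: "d > 0" and nbhd: "\<And>l y. cmod (l - lam) < d \<Longrightarrow> dist y x < d \<Longrightarrow>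
    y \<noteq> 0 \<and> (\<forall>i\<in>{1..m}. scalar_product (s i) y \<noteq> 0) \<and>
    (is_nep_solution m A B C r s l y \<longrightarrow> l = lam \<and> (\<exists>\<alpha>. y = \<alpha> *s x))"
    using nep_isolated_neighbourhood[OF iso sol] by auto
  \<comment> \<open>The norm is at most the sum of the moduli of \<open>CARD('n)\<close> entries, so
    \<open>CARD('n) * \<eta>\<close> has to stay below \<open>d\<close>; the added \<open>1\<close>
    makes this strict.\<close>
  define \<eta> where "\<eta> = d / (CARD('n) + 1)"
  have "\<eta> > 0"
    using d by (simp add: \<eta>_def)
  have "\<eta> * (CARD('n) + 1) = d"
    by (simp add: \<eta>_def)
  then have \<eta>: "CARD('n) * \<eta> < d" "\<eta> < d"
    using \<open>\<eta> > 0\<close> by (auto simp: algebra_simps intro: add_pos_nonneg)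
  have "w = ?z" if w: "w \<in> polydisc (chart_coords (Suc m) CARD('n) b) ?z \<eta>"
    and zero: "\<forall>i<CARD('n) + m. nep_biform m A B C r s e i w = 0" for w
  proof -
    have close: "cmod (w j - ?z j) \<le> \<eta>" for j
      using w \<open>\<eta> > 0\<close> by (cases "j \<in> chart_coords (Suc m) CARD('n) b") (auto simp: polydisc_def)
    have fixed: "w j = ?z j" if "j \<notin> chart_coords (Suc m) CARD('n) b" for j
      using w that by (simp add: polydisc_def)
    let ?y = "vec_of_point e w"
    have "dist ?y x = norm (?y - vec_of_point e ?z)"
      by (simp add: vec_of_nep_point[OF e] dist_norm)
    also have "\<dots> \<le> (\<Sum>j\<in>UNIV. cmod ((?y - vec_of_point e ?z) $ j))"
      unfolding norm_vec_def by (rule L2_set_le_sum) simp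
    also have "\<dots> \<le> (\<Sum>j\<in>(UNIV :: 'n set). \<eta>)"
      by (intro sum_mono) (simp add: vec_of_point_def close)
    finally have "dist ?y x < d"
      using \<eta>(1) by simp
    moreover have "cmod (w (Inl 0) - lam) < d"
      using close[of "Inl 0"] \<eta>(2) by (simp add: nep_point_def)
    ultimately have y: "?y \<noteq> 0" "\<And>i. i \<in> {1..m} \<Longrightarrow> scalar_product (s i) ?y \<noteq> 0"
      and impl: "is_nep_solution m A B C r s (w (Inl 0)) ?y \<Longrightarrow> w (Inl 0) = lam \<and> (\<exists>\<alpha>. ?y = \<alpha> *s x)"
      using nbhd[of "w (Inl 0)" ?y] by auto
    have "w (Inl (Suc m)) = 1"
      using fixed[of "Inl (Suc m)"] by (auto simp: nep_point_def chart_coords_def)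
    note eqs = nep_biform_zero_iff[OF e this y(2), THEN iffD1, OF _ zero]
    have "is_nep_solution m A B C r s (w (Inl 0)) ?y"
      unfolding is_nep_solution_def using y eqs by auto
    then obtain \<alpha> where \<alpha>: "w (Inl 0) = lam" "?y = \<alpha> *s x"
      using impl by auto
    have "?y $ e b = 1"
      using fixed[of "Inr b"] b by (simp add: vec_of_point_nth[OF e] nep_point_def chart_coords_def image_iff)
    then have yx: "?y = x"
      using \<alpha>(2) b(2) by simp
    show "w = ?z"
    proof
      fix j
      show "w j = ?z j"
      proof (cases j)
        case (Inl a)
        consider "a = 0" | "a \<in> {1..m}" | "a > m"
          by force
        then show ?thesis
        proof cases
          case 1
          then show ?thesis
            by (simp add: Inl \<alpha>(1) nep_point_def)
        next
          case 2
          then show ?thesis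
            using eqs by (auto simp: Inl yx nep_point_def)
        next
          case 3
          then have "j \<notin> chart_coords (Suc m) CARD('n) b"
            by (auto simp: Inl chart_coords_def)
          then show ?thesis
            by (rule fixed)
        qed
      next
        case (Inr b')
        show ?thesis
        proof (cases "b' < CARD('n)")
          case True
          then show ?thesis
            using vec_of_point_nth[OF e True, of w] by (simp add: Inr yx nep_point_def)
        next
          case False
          then have "j \<notin> chart_coords (Suc m) CARD('n) b"
            by (auto simp: Inr chart_coords_def)
          then show ?thesis
            by (rule fixed)
        qed
      qed
    qed
  qed
  then show ?thesis
    using \<open>\<eta> > 0\<close> by (intro exI[of _ \<eta>]) simp
qed

text \<open>Two solutions with the same parameters span a line of solutions, so neither is isolated.\<close>

lemma nep_isolated_determined_by_parameters:
  fixes x y :: "complex ^ 'n"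
  assumes iso: "(lam, proj_point x) isolated_in nep_solutions m A B C r s"
    and x: "is_nep_solution m A B C r s lam x" and y: "is_nep_solution m A B C r s lam y"
    and same: "\<And>i. i \<in> {1..m} \<Longrightarrow>
      scalar_product (r i) x / scalar_product (s i) x = scalar_product (r i) y / scalar_product (s i) y"
  shows "proj_point x = proj_point y"
proof -
  obtain d where d: "d > 0" and nbhd: "\<And>l y. cmod (l - lam) < d \<Longrightarrow> dist y x < d \<Longrightarrow>
    y \<noteq> 0 \<and> (\<forall>i\<in>{1..m}. scalar_product (s i) y \<noteq> 0) \<and>
    (is_nep_solution m A B C r s l y \<longrightarrow> l = lam \<and> (\<exists>\<alpha>. y = \<alpha> *s x))"
    using nep_isolated_neighbourhood[OF iso x] by auto
  have nz: "x \<noteq> 0" "y \<noteq> 0" "\<And>i. i \<in> {1..m} \<Longrightarrow> scalar_product (s i) x \<noteq> 0"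
    "\<And>i. i \<in> {1..m} \<Longrightarrow> scalar_product (s i) y \<noteq> 0"
    using x y by (auto simp: is_nep_solution_def)
  define t where "t = d / (2 * norm y)"
  have t: "t > 0" "t * norm y < d"
    using d nz(2) by (simp_all add: t_def)
  define w where "w = x + complex_of_real t *s y"
  have "norm (complex_of_real t *s y) = t * norm y"
    using t(1) unfolding norm_vec_def by (simp add: norm_mult L2_set_right_distrib)
  then have "dist w x < d"
    using t(2) by (simp add: w_def dist_norm)
  then have w: "w \<noteq> 0" "\<And>i. i \<in> {1..m} \<Longrightarrow> scalar_product (s i) w \<noteq> 0"
    and impl: "is_nep_solution m A B C r s lam w \<Longrightarrow> \<exists>\<alpha>. w = \<alpha> *s x"
    using nbhd[of lam w] d by auto
  \<comment> \<open>With the common quotient \<open>q\<close>, the relation between the two products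
    is linear in the vector and passes from \<open>x\<close> and \<open>y\<close> to
    \<open>w\<close>. Hence all three have the same matrix, whose kernel contains
    \<open>w\<close>.\<close>
  have quot: "scalar_product (r i) w / scalar_product (s i) w = scalar_product (r i) x / scalar_product (s i) x"
    if i: "i \<in> {1..m}" for i
  proof -
    define q where "q = scalar_product (r i) x / scalar_product (s i) x"
    have "scalar_product (r i) x = q * scalar_product (s i) x"
      using nz(3)[OF i] by (simp add: q_def)
    moreover have "scalar_product (r i) y = q * scalar_product (s i) y"
      using nz(4)[OF i] by (simp add: q_def same[OF i])
    ultimately have "scalar_product (r i) w = q * scalar_product (s i) w"
      by (simp add: w_def scalar_product_add scalar_product_scale algebra_simps)
    then show ?thesis
      using w(2)[OF i] by (simp add: q_def)
  qed
  have "nep_matrix m A B C r s lam w = nep_matrix m A B C r s lam x"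
    unfolding nep_matrix_def by (simp add: quot)
  moreover have "nep_matrix m A B C r s lam y = nep_matrix m A B C r s lam x"
    unfolding nep_matrix_def by (simp add: same)
  ultimately have "nep_matrix m A B C r s lam w *v w = 0"
    using x y by (simp add: is_nep_solution_def w_def matrix_vector_right_distrib vector_scalar_commute
        flip: scalar_matrix_assoc)
  then obtain \<alpha> where \<alpha>: "w = \<alpha> *s x"
    using impl w unfolding is_nep_solution_def by auto
  have "y = ((\<alpha> - 1) / complex_of_real t) *s x"
  proof -
    have "complex_of_real t * y $ j = (\<alpha> - 1) * x $ j" for j
      using \<alpha> by (simp add: w_def vec_eq_iff algebra_simps)
    then show ?thesis
      using t(1) by (simp add: vec_eq_iff field_simps)
  qed
  then show ?thesis
    using proj_point_eq_iff[OF nz(1,2)] nz(2) by (metis vector_smult_lzero)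
qed

theorem theorem3p1:
  fixes m :: nat
    and A B :: "complex ^ 'n ^ 'n"
    and C :: "nat \<Rightarrow> complex ^ 'n ^ 'n"
    and r s :: "nat \<Rightarrow> complex ^ 'n"
  assumes "m \<ge> 1"
  shows "finite {p. p isolated_in nep_solutions m A B C r s} \<and>
    card {p. p isolated_in nep_solutions m A B C r s} \<le> (CARD('n) + m) choose (m + 1)"
proof (rule finite_if_finite_subsets_card_bdd)
  \<comment> \<open>A bound on every finite subset proves finiteness and the bound on the
    cardinality together.\<close>
  fix Q assume Q: "Q \<subseteq> {p. p isolated_in nep_solutions m A B C r s}" "finite Q"
  obtain e :: "nat \<Rightarrow> 'n" where e: "bij_betw e {..<CARD('n)} UNIV"
    using ex_bij_betw_nat_finite[OF finite[of "UNIV :: 'n set"]] by (auto simp: atLeast0LessThan)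
  have "\<forall>p\<in>Q. \<exists>lam x b. p = (lam, proj_point x) \<and> is_nep_solution m A B C r s lam x \<and>
      b < CARD('n) \<and> x $ e b = 1"
    using Q(1) by (intro ballI nep_normalized_solution[OF e]) (auto simp: isolated_in_def)
  then obtain lam x b where W: "\<forall>p\<in>Q. p = (lam p, proj_point (x p)) \<and>
      is_nep_solution m A B C r s (lam p) (x p) \<and> b p < CARD('n) \<and> x p $ e (b p) = 1"
    unfolding bchoice_iff by (elim exE) (rule that)
  note W = bspec[OF W]
  define z where "z = (\<lambda>p. nep_point m r s e (lam p) (x p))"
  have same: "p = p'" if pp': "p \<in> Q" "p' \<in> Q" and eq: "\<And>a. a < Suc m \<Longrightarrow> z p (Inl a) = z p' (Inl a)" for p p'
  proof -
    have lam: "lam p = lam p'"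
      using eq[of 0] by (simp add: z_def nep_point_def)
    have "proj_point (x p) = proj_point (x p')"
    proof (rule nep_isolated_determined_by_parameters)
      show "(lam p, proj_point (x p)) isolated_in nep_solutions m A B C r s"
        using W[OF pp'(1)] Q(1) pp'(1) by auto
      show "is_nep_solution m A B C r s (lam p) (x p)"
        "is_nep_solution m A B C r s (lam p) (x p')"
        using W[OF pp'(1)] W[OF pp'(2)] lam by auto
      show "scalar_product (r i) (x p) / scalar_product (s i) (x p)
          = scalar_product (r i) (x p') / scalar_product (s i) (x p')"
        if "i \<in> {1..m}" for i
        using eq[of i] that by (auto simp: z_def nep_point_def)
    qed
    then show ?thesis
      using W[OF pp'(1)] W[OF pp'(2)] lam by metis
  qed
  have "inj_on z Q"
    by (rule inj_onI) (use same in simp)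
  then have "card Q = card (z ` Q)"
    by (simp add: card_image)
  also have "\<dots> \<le> (CARD('n) + m) choose Suc m"
  \<comment> \<open>Charts are indexed by points there, while \<open>b\<close> is chosen per
    solution; \<open>z\<close> can be inverted because the parameters determine an isolated
    solution.\<close>
  proof (rule isolated_zeros_bound[where b = "\<lambda>w. b (inv_into Q z w)"
        and n = "CARD('n)" and ?C0.0 = "\<lambda>i a b. nep_rows m A B C r s e i a $ e b"])
    show "Suc (CARD('n) + m) = CARD('n) + Suc m" "finite (z ` Q)"
      using Q(2) by simp_all
  next
    fix w assume "w \<in> z ` Q"
    then obtain p where p: "p \<in> Q" "w = z p"
      by auto
    have inv: "inv_into Q z w = p"
      using \<open>inj_on z Q\<close> p by simp
    note Wp = W[OF p(1)]
    show "b (inv_into Q z w) < CARD('n) \<and> w (Inl (Suc m)) = 1 \<and>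
        w (Inr (b (inv_into Q z w))) = 1"
      using Wp unfolding inv by (simp add: p(2) z_def nep_point_def)
    have sol: "is_nep_solution m A B C r s (lam p) (x p)"
      using Wp by simp
    have "\<forall>i<CARD('n) + m. nep_biform m A B C r s e i w = 0"
      unfolding p(2) z_def by (rule nep_biform_nep_point[OF e sol])
    then show "biform (Suc m) CARD('n) (\<lambda>a b. nep_rows m A B C r s e i a $ e b) w = 0"
      if "i < CARD('n) + m" for i
      using that by (simp add: nep_biform_def)
    have "(lam p, proj_point (x p)) isolated_in nep_solutions m A B C r s"
      using Wp Q(1) p(1) by auto
    from nep_point_isolated[OF e this sol, of "b p"] Wp
    have "\<exists>\<eta>>0. \<forall>v\<in>polydisc (chart_coords (Suc m) CARD('n) (b p)) w \<eta>.
        (\<forall>i<CARD('n) + m. nep_biform m A B C r s e i v = 0) \<longrightarrow> v = w"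
      by (simp add: p(2) z_def)
    then show "\<exists>\<eta>>0. \<forall>v\<in>polydisc (chart_coords (Suc m) CARD('n) (b (inv_into Q z w))) w \<eta>.
        (\<forall>i<CARD('n) + m. biform (Suc m) CARD('n) (\<lambda>a b. nep_rows m A B C r s e i a $ e b) v = 0) \<longrightarrow> v = w"
      by (simp only: inv nep_biform_def)
  next
    fix v w assume "v \<in> z ` Q" "w \<in> z ` Q" "v \<noteq> w"
    then obtain p p' where "p \<in> Q" "p' \<in> Q" "v = z p" "w = z p'" "p \<noteq> p'"
      by auto
    then show "\<exists>a<Suc m. v (Inl a) \<noteq> w (Inl a)"
      using same[of p p'] by auto
  qed
  finally show "card Q \<le> (CARD('n) + m) choose (m + 1)"
    by simp
qed

end
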